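(* Let $f$ be the aZagreb topological index, and let $G$ be a chemical graph of order $n$ and size $m$. Then: (a) if $(n,m)\notin\{(7,8),(8,8)\}$, $G$ maximizes $f$ over all chemical graphs of the same order and size as $G$ if and only if $G\in F_8$; (b) if $n=7$ and $m=8$, $G$ maximizes $f$ over all chemical graphs of order $7$ and size $8$ if and only if $x_{12}=x_{13}=x_{23}=1$, $x_{22}=0$ and $x_{33}=5$; (c) if $n=8$ and $m=8$, $G$ maximizes $f$ over all chemical graphs of order $8$ and size $8$ if and only if $x_{12}=x_{23}=2$, $x_{13}=1$, $x_{22}=0$ and $x_{33}=3$.
   Context: All graphs are finite, simple and undirected. A chemical graph is a connected graph of order (number of vertices) $n\ge 7$, size (number of edges) $m\le \frac{3n-3}{2}$ and maximum degree at most $3$. For such a graph, $x_{ij}$ ($i\le j$) denotes the number of $(i,j)$-edges, i.e. edges whose endpoints have degrees $i$ and $j$ (necessarily $x_{11}=0$). A degree-based topological index is a function of the form $f(G)=c_{12}x_{12}+c_{13}x_{13}+c_{22}x_{22}+c_{23}x_{23}+c_{33}x_{33}$ with real coefficients $c_{ij}$. The aZagreb (augmented Zagreb) index is the one with $c_{ij}=\left(\frac{ij}{i+j-2}\right)^3$. For an integer $a$, $a \bmod 3\in\{0,1,2\}$ denotes the remainder modulo 3. $F_8$ is the set of chemical graphs (of order $n$ and size $m$) with $(x_{12},x_{13},x_{22},x_{23},x_{33})$ equal to - $(2,0,m-2,0,0)$ or $(3,0,m-6,3,0)$ if $m+1=n\in\{7,8,9\}$; - $(2,0,m-7,4,1)$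 if $m=n\in\{7,8\}$; - $(1,0,1,3,3)$ if $n=7$ and $m=8$; - $\left(\lfloor\frac{3n-2m}{3}\rfloor,0,m\bmod 3,\lfloor\frac{3n-2m}{3}\rfloor,\lfloor\frac{7m-6n}{3}\rfloor\right)$ otherwise. *)

theory Defs
  imports Complex_Main "Graph_Theory.Graph_Theory"
begin

text \<open>
  A finite simple undirected graph is a \<^const>\<open>pair_graph\<close>: a finite, loop-free, symmetric
  set of arcs. An undirected edge \<open>{u, v}\<close> is represented by the two arcs \<open>(u, v)\<close> and \<open>(v, u)\<close>,
  so edges are counted as two-element sets, not as arcs, while the degree of a vertex is its
  out-degree.
\<close>

definition uedges :: "'a pair_pre_digraph \<Rightarrow> 'a set set" where
  "uedges G = {{u, v} | u v. (u, v) \<in> parcs G}"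

definition graph_order :: "'a pair_pre_digraph \<Rightarrow> nat" where
  "graph_order G = card (pverts G)"

definition graph_size :: "'a pair_pre_digraph \<Rightarrow> nat" where
  "graph_size G = card (uedges G)"

definition deg :: "'a pair_pre_digraph \<Rightarrow> 'a \<Rightarrow> nat" where
  "deg G v = out_degree (with_proj G) v"

definition chemical_graph :: "'a pair_pre_digraph \<Rightarrow> bool" where
  "chemical_graph G \<longleftrightarrow>
     pair_graph G \<and> connected (with_proj G) \<and>
     graph_order G \<ge> 7 \<and>
     real (graph_size G) \<le> (3 * real (graph_order G) - 3) / 2 \<and>
     (\<forall>v \<in> pverts G. deg G v \<le> 3)"

definition edge_count :: "'a pair_pre_digraph \<Rightarrow> nat \<Rightarrow> nat \<Rightarrow> nat" where
  "edge_count G i j = card {e \<in> uedges G. \<exists>u v. e = {u, v} \<and> deg G u = i \<and> deg G v = j}"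

definition degree_based_index :: "(nat \<Rightarrow> nat \<Rightarrow> real) \<Rightarrow> 'a pair_pre_digraph \<Rightarrow> real" where
  "degree_based_index c G =
     c 1 2 * edge_count G 1 2 + c 1 3 * edge_count G 1 3 + c 2 2 * edge_count G 2 2 +
     c 2 3 * edge_count G 2 3 + c 3 3 * edge_count G 3 3"

definition aZagreb :: "'a pair_pre_digraph \<Rightarrow> real" where
  "aZagreb = degree_based_index (\<lambda>i j. ((real i * real j) / (real i + real j - 2)) ^ 3)"

text \<open>
  The competitors \<open>H\<close> have the same vertex type as \<open>G\<close>. This loses no generality: a finite graph
  with as many vertices as \<open>G\<close> has an isomorphic copy on the vertex set of \<open>G\<close>.
\<close>

definition maximizes :: "('a pair_pre_digraph \<Rightarrow> real) \<Rightarrow> 'a pair_pre_digraph \<Rightarrow> bool" where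
  "maximizes f G \<longleftrightarrow>
     chemical_graph G \<and>
     (\<forall>H. chemical_graph H \<and> graph_order H = graph_order G \<and> graph_size H = graph_size G
        \<longrightarrow> f H \<le> f G)"

definition edge_vector :: "'a pair_pre_digraph \<Rightarrow> int \<times> int \<times> int \<times> int \<times> int" where
  "edge_vector G =
     (int (edge_count G 1 2), int (edge_count G 1 3), int (edge_count G 2 2),
      int (edge_count G 2 3), int (edge_count G 3 3))"

text \<open>On \<^typ>\<open>int\<close>, \<open>a div 3\<close> is the floor of \<open>a / 3\<close>.\<close>

definition F8 :: "'a pair_pre_digraph set" where
  "F8 = {G. chemical_graph G \<and>
     (let n = int (graph_order G); m = int (graph_size G); x = edge_vector G in
        if m + 1 = n \<and> n \<in> {7, 8, 9} then x = (2, 0, m - 2, 0, 0) \<or> x = (3, 0, m - 6, 3, 0)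
        else if m = n \<and> n \<in> {7, 8} then x = (2, 0, m - 7, 4, 1)
        else if n = 7 \<and> m = 8 then x = (1, 0, 1, 3, 3)
        else x = ((3 * n - 2 * m) div 3, 0, m mod 3, (3 * n - 2 * m) div 3, (7 * m - 6 * n) div 3))}"

end

theory Submission
  imports Defs
begin

text \<open>
  The coefficients of the index are \<open>8\<close> for the edge types \<open>12\<close>, \<open>22\<close> and \<open>23\<close>, \<open>27/8\<close> for \<open>13\<close>
  and \<open>729/64\<close> for \<open>33\<close>. Hence \<open>64 f = 512 m + (217 x33 - 296 x13)\<close>, and for fixed size \<open>m\<close> the
  problem is to maximize the integer \<open>217 x33 - 296 x13\<close>, called the score below.

  Upper bound. Double counting expresses order and size through the five edge counts
  (\<open>size_eq\<close>, \<open>class_sizes\<close>) and gives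
  \<open>3 x33 = (7m - 6n) - 2 (x23 - x12) + x13 - x22\<close>.
  If some vertex has degree three, then \<open>x12 \<le> x23\<close> (\<open>leg_count\<close>): every hanging path ends at such a
  vertex. Besides, \<open>x12 + x23\<close> is even. In the score, an edge of type \<open>13\<close> gains one third of
  \<open>217\<close> and pays \<open>296\<close>, so an optimum wants \<open>x13 = 0\<close>, \<open>x12 = x23\<close>, and the smallest \<open>x22\<close> that makes
  \<open>x33\<close> integral, namely \<open>m mod 3\<close>. A graph without a vertex of degree three is a path or a
  cycle; a path can tie with the bound only when the bound is \<open>0\<close>, that is for trees of order
  at most \<open>9\<close> (\<open>score_bound\<close>).

  Attainment. A graph with these edge counts is a connected subcubic core carrying all vertices
  of degree three, together with hanging paths of length two that raise every core vertex to
  degree three; the \<open>m mod 3\<close> remaining vertices lengthen one hanging path. A core with \<open>N\<close>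
  vertices and \<open>k\<close> edges exists for all the values of \<open>(N, k)\<close> that occur, except where a simple graph
  is too small to have \<open>k\<close> edges: \<open>(2, 2)\<close> and \<open>(3, 4)\<close> (\<open>subcubic_core\<close>). These two cases are the
  exceptional pairs \<open>(7, 7)\<close>, \<open>(8, 8)\<close> and \<open>(7, 8)\<close> of order and size. There the inequality \<open>x33 \<le> (n3 choose 2)\<close>,
  where \<open>n3\<close> is the number of vertices of degree three, excludes the better edge counts, and the
  next best ones are realized by a triangle or by \<open>K4\<close> minus an edge with hanging paths.
\<close>

section \<open>Connected graphs as sets of two-element edges\<close>

definition vdeg :: "'a set set \<Rightarrow> 'a \<Rightarrow> nat" where
  "vdeg E v = card {e \<in> E. v \<in> e}"

definition adj :: "'a set set \<Rightarrow> ('a \<times> 'a) set" where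
  "adj E = {(u, v). {u, v} \<in> E}"

definition conn_graph :: "'a set \<Rightarrow> 'a set set \<Rightarrow> bool" where
  "conn_graph V E \<longleftrightarrow> finite V \<and> V \<noteq> {} \<and> (\<forall>e\<in>E. e \<subseteq> V \<and> card e = 2) \<and>
     (\<forall>u\<in>V. \<forall>v\<in>V. (u, v) \<in> (adj E)\<^sup>*)"

definition type_edges :: "'a set set \<Rightarrow> nat \<Rightarrow> nat \<Rightarrow> 'a set set" where
  "type_edges E i j = {e \<in> E. \<exists>u v. e = {u, v} \<and> vdeg E u = i \<and> vdeg E v = j}"

lemma conn_graph_finite:
  assumes "conn_graph V E"
  shows "finite V" and "finite E"
proof -
  show "finite V" using assms by (simp add: conn_graph_def)
  moreover have "E \<subseteq> Pow V" using assms by (auto simp: conn_graph_def)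
  ultimately show "finite E" by (meson finite_Pow_iff finite_subset)
qed

lemma conn_graph_edge:
  assumes "conn_graph V E" "e \<in> E"
  obtains u v where "e = {u, v}" "u \<noteq> v" "u \<in> V" "v \<in> V"
proof -
  have "e \<subseteq> V" "card e = 2" using assms by (simp_all add: conn_graph_def)
  then show thesis using that unfolding card_2_iff by blast
qed

lemma conn_graph_doubleton:
  assumes "conn_graph V E" "{u, v} \<in> E"
  shows "u \<noteq> v" "u \<in> V" "v \<in> V"
proof -
  have *: "{u, v} \<subseteq> V" "card {u, v} = 2" using assms unfolding conn_graph_def by blast+
  show "u \<noteq> v" using *(2) by auto
  show "u \<in> V" "v \<in> V" using *(1) by auto
qed

lemma vdeg_ge_card:
  assumes "finite E" "S \<subseteq> E" "\<And>e. e \<in> S \<Longrightarrow> v \<in> e"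
  shows "card S \<le> vdeg E v"
  unfolding vdeg_def using assms by (intro card_mono) auto

lemma handshake:
  assumes "conn_graph V E" "A \<subseteq> V"
  shows "(\<Sum>v\<in>A. vdeg E v) = (\<Sum>e\<in>E. card (A \<inter> e))"
proof -
  have fin: "finite A" "finite E"
    using conn_graph_finite[OF assms(1)] assms(2) finite_subset by auto
  have "(\<Sum>v\<in>A. vdeg E v) = (\<Sum>v\<in>A. \<Sum>e | e \<in> E \<and> v \<in> e. 1)"
    by (simp add: vdeg_def)
  also have "\<dots> = (\<Sum>e\<in>E. \<Sum>v | v \<in> A \<and> v \<in> e. 1)"
    using fin by (rule sum.swap_restrict)
  also have "\<dots> = (\<Sum>e\<in>E. card (A \<inter> e))"
    by (simp add: Int_def)
  finally show ?thesis .
qed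

lemma degree_sum:
  assumes "conn_graph V E"
  shows "(\<Sum>v\<in>V. vdeg E v) = 2 * card E"
proof -
  have "(\<Sum>e\<in>E. card (V \<inter> e)) = (\<Sum>e\<in>E. 2)"
    using assms by (intro sum.cong) (auto simp: conn_graph_def Int_absorb1)
  then show ?thesis using handshake[OF assms order_refl] by simp
qed

text \<open>
The distance \<open>\<delta>\<close> to the set \<open>C\<close> drops along some edge at every vertex outside \<open>C\<close>. This is the only form
in which connectivity enters the counting arguments: choosing such an edge orients the graph
towards \<open>C\<close> without cycles.
\<close>

lemma descending_neighbour:
  assumes "conn_graph V E" "C \<subseteq> V" "C \<noteq> {}"
  shows "\<exists>(\<delta> :: 'a \<Rightarrow> nat) nxt. \<forall>v\<in>V - C. {v, nxt v} \<in> E \<and> \<delta> (nxt v) < \<delta> v"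
proof -
  define \<delta> where "\<delta> v = (LEAST k. \<exists>c\<in>C. (v, c) \<in> adj E ^^ k)" for v
  have "\<exists>w. {v, w} \<in> E \<and> \<delta> w < \<delta> v" if "v \<in> V - C" for v
  proof -
    from assms(3) obtain c0 where c0: "c0 \<in> C" by blast
    then have "(v, c0) \<in> (adj E)\<^sup>*" using assms(1,2) that unfolding conn_graph_def by blast
    then obtain k where "(v, c0) \<in> adj E ^^ k" using rtrancl_imp_relpow by blast
    with c0 have "\<exists>k. \<exists>c\<in>C. (v, c) \<in> adj E ^^ k" by blast
    from LeastI_ex[OF this] have "\<exists>c\<in>C. (v, c) \<in> adj E ^^ \<delta> v" unfolding \<delta>_def .
    then obtain c where c: "c \<in> C" "(v, c) \<in> adj E ^^ \<delta> v" by blast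
    have "\<delta> v \<noteq> 0"
    proof
      assume "\<delta> v = 0"
      with c(2) have "v = c" by simp
      with c(1) that show False by blast
    qed
    then obtain j where j: "\<delta> v = Suc j" using not0_implies_Suc by blast
    with c(2) obtain w where w: "(v, w) \<in> adj E" "(w, c) \<in> adj E ^^ j"
      by (metis relpow_Suc_D2)
    have "\<delta> w \<le> j" unfolding \<delta>_def using w(2) c(1) by (intro Least_le) blast
    then show ?thesis using w(1) j by (auto simp: adj_def)
  qed
  then show ?thesis by metis
qed

text \<open>
The edges chosen towards a root are pairwise distinct, since a common edge of \<open>v\<close> and \<open>w\<close> would
decrease the distance in both directions.
\<close>

lemma card_vertices_le:
  assumes G: "conn_graph V E"
  shows "card V \<le> card E + 1"
proof -
  obtain r where r: "r \<in> V" using G by (auto simp: conn_graph_def)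
  obtain \<delta> :: "'a \<Rightarrow> nat" and nxt
    where nxt: "\<forall>v\<in>V - {r}. {v, nxt v} \<in> E \<and> \<delta> (nxt v) < \<delta> v"
    using descending_neighbour[OF G, of "{r}"] r by blast
  have "inj_on (\<lambda>v. {v, nxt v}) (V - {r})"
  proof (rule inj_onI)
    fix v w assume "v \<in> V - {r}" "w \<in> V - {r}" "{v, nxt v} = {w, nxt w}"
    then show "v = w" using bspec[OF nxt, of v] bspec[OF nxt, of w] by (auto simp: doubleton_eq_iff)
  qed
  then have "card (V - {r}) \<le> card E"
    using nxt conn_graph_finite[OF G] by (intro card_inj_on_le) auto
  then show ?thesis using r conn_graph_finite[OF G] by simp
qed

section \<open>Counting edges by the degrees of their ends\<close>

locale subcubic_graph =
  fixes V :: "'a set" and E :: "'a set set"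
  assumes conn: "conn_graph V E"
    and three: "card V \<ge> 3"
    and deg_le: "\<And>v. v \<in> V \<Longrightarrow> vdeg E v \<le> 3"
begin

abbreviation "x i j \<equiv> card (type_edges E i j)"

definition deg_class :: "nat \<Rightarrow> 'a set" where
  "deg_class i = {v \<in> V. vdeg E v = i}"

lemma fin: "finite V" "finite E" "finite (deg_class i)" "finite (type_edges E i j)"
  using conn_graph_finite[OF conn] by (auto simp: deg_class_def type_edges_def)

lemma deg_pos:
  assumes "v \<in> V"
  shows "vdeg E v \<ge> 1"
proof -
  have "card {v} < card V" using three by simp
  then obtain r where r: "r \<in> V" "r \<noteq> v"
    by (metis card_mono finite.emptyI finite_insert insertCI linorder_not_le subsetI)
  obtain \<delta> :: "'a \<Rightarrow> nat" and nxt
    where nxt: "\<forall>v\<in>V - {r}. {v, nxt v} \<in> E \<and> \<delta> (nxt v) < \<delta> v"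
    using descending_neighbour[OF conn, of "{r}"] r by blast
  have "card {{v, nxt v}} \<le> vdeg E v"
    using bspec[OF nxt, of v] assms r fin(2) by (intro vdeg_ge_card) auto
  then show ?thesis by simp
qed

text \<open>
Two adjacent leaves would form a connected component, which a third vertex contradicts.
\<close>

lemma no_leaf_leaf_edge:
  assumes "{u, v} \<in> E" "vdeg E u = 1"
  shows "vdeg E v \<noteq> 1"
proof
  assume v1: "vdeg E v = 1"
  have uv: "u \<noteq> v" "u \<in> V" "v \<in> V" using conn_graph_doubleton[OF conn assms(1)] by auto
  have "card {u, v} < card V" using three uv(1) by simp
  then obtain r where r: "r \<in> V" "r \<noteq> u" "r \<noteq> v"
    by (metis card_mono finite.emptyI finite_insert insertCI linorder_not_le subsetI)
  obtain \<delta> :: "'a \<Rightarrow> nat" and nxt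
    where nxt: "\<forall>v\<in>V - {r}. {v, nxt v} \<in> E \<and> \<delta> (nxt v) < \<delta> v"
    using descending_neighbour[OF conn, of "{r}"] r by blast
  have only: "e = e'" if "vdeg E w = 1" "e \<in> E" "e' \<in> E" "w \<in> e" "w \<in> e'" for w e e'
  proof -
    have "card {e \<in> E. w \<in> e} = 1" using that(1) by (simp add: vdeg_def)
    then obtain a where a: "{e \<in> E. w \<in> e} = {a}" by (rule card_1_singletonE)
    have "e \<in> {e \<in> E. w \<in> e}" "e' \<in> {e \<in> E. w \<in> e}" using that by simp_all
    then show ?thesis unfolding a by simp
  qed
  have nu: "{u, nxt u} \<in> E" "\<delta> (nxt u) < \<delta> u" and nv: "{v, nxt v} \<in> E" "\<delta> (nxt v) < \<delta> v"
    using nxt uv r by blast+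
  have "{u, nxt u} = {u, v}" by (rule only[OF assms(2) nu(1) assms(1)]) simp_all
  moreover have "{v, nxt v} = {u, v}" by (rule only[OF v1 nv(1) assms(1)]) simp_all
  ultimately have "nxt u = v" "nxt v = u" using uv(1) by (auto simp: doubleton_eq_iff)
  then show False using nu(2) nv(2) by simp
qed

lemma edge_types:
  assumes "e \<in> E"
  shows "e \<in> type_edges E 1 2 \<union> type_edges E 1 3 \<union> type_edges E 2 2 \<union> type_edges E 2 3
    \<union> type_edges E 3 3"
proof -
  obtain u v where e: "e = {u, v}" "u \<in> V" "v \<in> V" using conn_graph_edge[OF conn assms] by metis
  have d: "vdeg E u \<in> {1, 2, 3}" "vdeg E v \<in> {1, 2, 3}"
    using deg_pos[OF e(2)] deg_le[OF e(2)] deg_pos[OF e(3)] deg_le[OF e(3)] by auto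
  have "\<not> (vdeg E u = 1 \<and> vdeg E v = 1)" using no_leaf_leaf_edge[of u v] assms e by auto
  moreover have "e \<in> type_edges E (vdeg E u) (vdeg E v)"
    using assms e unfolding type_edges_def by blast
  moreover have "e \<in> type_edges E (vdeg E v) (vdeg E u)"
    using assms e unfolding type_edges_def by blast
  ultimately show ?thesis using d by auto
qed

text \<open>
Size and class sizes are sums over edges of a weight that splits into one contribution \<open>h\<close> of the
degree of each end.
\<close>

lemma sum_over_types:
  fixes g :: "'a set \<Rightarrow> nat"
  assumes g: "\<And>u v. {u, v} \<in> E \<Longrightarrow> u \<noteq> v \<Longrightarrow> u \<in> V \<Longrightarrow> v \<in> V \<Longrightarrow>
    g {u, v} = h (vdeg E u) + h (vdeg E v)"
  shows "(\<Sum>e\<in>E. g e) = (h 1 + h 2) * x 1 2 + (h 1 + h 3) * x 1 3 + 2 * h 2 * x 2 2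
    + (h 2 + h 3) * x 2 3 + 2 * h 3 * x 3 3"
proof -
  let ?T = "type_edges E"
  have E: "E = (((?T 1 2 \<union> ?T 1 3) \<union> ?T 2 2) \<union> ?T 2 3) \<union> ?T 3 3"
  proof (rule equalityI)
    show "E \<subseteq> (((?T 1 2 \<union> ?T 1 3) \<union> ?T 2 2) \<union> ?T 2 3) \<union> ?T 3 3"
      by (rule subsetI) (rule edge_types)
    have "?T i j \<subseteq> E" for i j by (simp add: type_edges_def)
    then show "(((?T 1 2 \<union> ?T 1 3) \<union> ?T 2 2) \<union> ?T 2 3) \<union> ?T 3 3 \<subseteq> E" by simp
  qed
  have S: "(\<Sum>e\<in>?T i j. g e) = (h i + h j) * x i j" for i j
  proof -
    have "(\<Sum>e\<in>?T i j. g e) = (\<Sum>e\<in>?T i j. h i + h j)"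
    proof (rule sum.cong)
      fix e assume "e \<in> ?T i j"
      then obtain u v where e: "e \<in> E" "e = {u, v}" "vdeg E u = i" "vdeg E v = j"
        by (auto simp: type_edges_def)
      then have "u \<noteq> v" "u \<in> V" "v \<in> V" using conn_graph_doubleton[OF conn, of u v] by auto
      then show "g e = h i + h j" using g[of u v] e by auto
    qed simp
    then show ?thesis by simp
  qed
  have disj: "?T i j \<inter> ?T k l = {}" if "\<not> (i = k \<and> j = l)" "\<not> (i = l \<and> j = k)" for i j k l
    using that by (fastforce simp: type_edges_def doubleton_eq_iff)
  have U: "sum g (A \<union> B) = sum g A + sum g B" if "finite A" "finite B" "A \<inter> B = {}" for A B
    using that by (rule sum.union_disjoint)
  have "sum g E = sum g (?T 1 2 \<union> ?T 1 3 \<union> ?T 2 2 \<union> ?T 2 3) + sum g (?T 3 3)"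
    by (subst arg_cong[OF E, of "sum g"], rule U) (simp_all add: fin Int_Un_distrib2 disj)
  also have "sum g (?T 1 2 \<union> ?T 1 3 \<union> ?T 2 2 \<union> ?T 2 3)
    = sum g (?T 1 2 \<union> ?T 1 3 \<union> ?T 2 2) + sum g (?T 2 3)"
    by (rule U) (simp_all add: fin Int_Un_distrib2 disj)
  also have "sum g (?T 1 2 \<union> ?T 1 3 \<union> ?T 2 2) = sum g (?T 1 2 \<union> ?T 1 3) + sum g (?T 2 2)"
    by (rule U) (simp_all add: fin Int_Un_distrib2 disj)
  also have "sum g (?T 1 2 \<union> ?T 1 3) = sum g (?T 1 2) + sum g (?T 1 3)"
    by (rule U) (simp_all add: fin disj)
  finally show ?thesis unfolding S by (simp add: mult_2)
qed

lemma size_eq: "card E = x 1 2 + x 1 3 + x 2 2 + x 2 3 + x 3 3"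
proof -
  have "2 * card E = (\<Sum>e\<in>E. 2)" by simp
  also have "\<dots> = 2 * (x 1 2 + x 1 3 + x 2 2 + x 2 3 + x 3 3)"
    using sum_over_types[of "\<lambda>_. 2" "\<lambda>_. 1"] by simp
  finally show ?thesis by simp
qed

lemma class_handshake:
  "i * card (deg_class i) = (\<Sum>e\<in>E. card (deg_class i \<inter> e))"
proof -
  have "(\<Sum>v\<in>deg_class i. vdeg E v) = (\<Sum>v\<in>deg_class i. i)"
    by (rule sum.cong) (auto simp: deg_class_def)
  then show ?thesis using handshake[OF conn, of "deg_class i"]
    by (simp add: deg_class_def mult.commute)
qed

lemma class_sizes:
  "card (deg_class 1) = x 1 2 + x 1 3"
  "2 * card (deg_class 2) = x 1 2 + 2 * x 2 2 + x 2 3"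
  "3 * card (deg_class 3) = x 1 3 + x 2 3 + 2 * x 3 3"
proof -
  have *: "card (deg_class i \<inter> {u, v}) = of_bool (vdeg E u = i) + of_bool (vdeg E v = i)"
    if "u \<noteq> v" "u \<in> V" "v \<in> V" for i u v
    using that by (auto simp: deg_class_def Int_insert_right)
  have "i * card (deg_class i) = (of_bool (1 = i) + of_bool (2 = i)) * x 1 2
    + (of_bool (1 = i) + of_bool (3 = i)) * x 1 3 + 2 * of_bool (2 = i) * x 2 2
    + (of_bool (2 = i) + of_bool (3 = i)) * x 2 3 + 2 * of_bool (3 = i) * x 3 3" for i
    unfolding class_handshake
    by (rule sum_over_types[of _ "\<lambda>k. of_bool (k = i)"]) (simp add: *)
  from this[of 1] this[of 2] this[of 3] show
    "card (deg_class 1) = x 1 2 + x 1 3"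
    "2 * card (deg_class 2) = x 1 2 + 2 * x 2 2 + x 2 3"
    "3 * card (deg_class 3) = x 1 3 + x 2 3 + 2 * x 3 3" by simp_all
qed

lemma order_eq: "card V = card (deg_class 1) + card (deg_class 2) + card (deg_class 3)"
proof -
  have "V \<subseteq> (deg_class 1 \<union> deg_class 2) \<union> deg_class 3"
  proof
    fix v assume v: "v \<in> V"
    have "vdeg E v = 1 \<or> vdeg E v = 2 \<or> vdeg E v = 3"
      using deg_pos[OF v] deg_le[OF v] by linarith
    with v show "v \<in> (deg_class 1 \<union> deg_class 2) \<union> deg_class 3" by (auto simp: deg_class_def)
  qed
  moreover have "deg_class i \<subseteq> V" for i by (auto simp: deg_class_def)
  ultimately have "V = (deg_class 1 \<union> deg_class 2) \<union> deg_class 3" by blast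
  then have "card V = card ((deg_class 1 \<union> deg_class 2) \<union> deg_class 3)" by (rule arg_cong)
  also have "\<dots> = card (deg_class 1 \<union> deg_class 2) + card (deg_class 3)"
    using fin by (intro card_Un_disjoint) (auto simp: deg_class_def)
  also have "card (deg_class 1 \<union> deg_class 2) = card (deg_class 1) + card (deg_class 2)"
    using fin by (intro card_Un_disjoint) (auto simp: deg_class_def)
  finally show ?thesis .
qed

lemma cubic_edges_le: "x 3 3 \<le> card (deg_class 3) choose 2"
proof -
  have "type_edges E 3 3 \<subseteq> {S. S \<subseteq> deg_class 3 \<and> card S = 2}"
    using conn_graph_doubleton[OF conn] by (fastforce simp: type_edges_def deg_class_def)
  then have "x 3 3 \<le> card {S. S \<subseteq> deg_class 3 \<and> card S = 2}"
    using fin by (intro card_mono) auto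
  then show ?thesis using n_subsets[OF fin(3)] by simp
qed

text \<open>
Orient each vertex \<open>v\<close> of degree at most two by an edge to a vertex \<open>nxt v\<close> that is closer to the
vertices of degree three, and call the set of these vertices \<open>D\<close>. If \<open>nxt\<close> maps two of them to the
same \<open>c\<close> in \<open>D\<close>, then \<open>c\<close> has these two neighbours and also \<open>nxt c\<close>, so degree three; if \<open>nxt\<close> maps one to
\<open>c\<close> in \<open>D\<close>, then \<open>c\<close> is not a leaf. So the vertices that stay in \<open>D\<close> (the set \<open>B\<close>) inject into the
non-leaves of \<open>D\<close>. Comparing cardinalities, at least as many vertices step out of \<open>D\<close> (the set \<open>A\<close>)
as there are leaves, and each such step is an edge of type \<open>13\<close> or \<open>23\<close> of its own.
\<close>

lemma leg_count:
  assumes "deg_class 3 \<noteq> {}"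
  shows "x 1 2 \<le> x 2 3"
proof -
  define D where "D = V - deg_class 3"
  have D: "v \<in> D \<longleftrightarrow> v \<in> V \<and> vdeg E v \<le> 2" for v
    using deg_le[of v] by (auto simp: D_def deg_class_def)
  have finD: "finite D" using fin by (simp add: D_def)
  obtain \<delta> :: "'a \<Rightarrow> nat" and nxt
    where nxt: "\<forall>v\<in>V - deg_class 3. {v, nxt v} \<in> E \<and> \<delta> (nxt v) < \<delta> v"
    using descending_neighbour[OF conn _ assms] unfolding deg_class_def by blast
  have n: "{v, nxt v} \<in> E" "\<delta> (nxt v) < \<delta> v" "nxt v \<in> V" "v \<noteq> nxt v" if "v \<in> D" for v
    using bspec[OF nxt, of v] that conn_graph_doubleton[OF conn, of v "nxt v"] by (auto simp: D_def)
  define B where "B = {v \<in> D. nxt v \<in> D}"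
  define A where "A = {v \<in> D. nxt v \<notin> D}"
  have "inj_on nxt B"
  proof (rule inj_onI, rule ccontr)
    fix a b assume ab: "a \<in> B" "b \<in> B" "nxt a = nxt b" "a \<noteq> b"
    let ?c = "nxt a"
    have c: "?c \<in> D" "a \<in> D" "b \<in> D" using ab by (auto simp: B_def)
    have "card {{a, ?c}, {b, ?c}, {?c, nxt ?c}} \<le> vdeg E ?c"
      using n[OF c(1)] n[OF c(2)] n[OF c(3)] ab(3) fin(2) by (intro vdeg_ge_card) auto
    moreover have "card {{a, ?c}, {b, ?c}, {?c, nxt ?c}} = 3"
      using n[OF c(1)] n[OF c(2)] n[OF c(3)] ab(3,4) by (auto simp: card_insert_if doubleton_eq_iff)
    ultimately show False using c(1) D by auto
  qed
  then have "card B = card (nxt ` B)" by (simp add: card_image)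
  also have "\<dots> \<le> card (D - deg_class 1)"
  proof (rule card_mono)
    show "nxt ` B \<subseteq> D - deg_class 1"
    proof
      fix c assume "c \<in> nxt ` B"
      then obtain a where a: "c = nxt a" "a \<in> D" "c \<in> D" by (auto simp: B_def)
      have "card {{a, c}, {c, nxt c}} \<le> vdeg E c"
        using n[OF a(2)] n[OF a(3)] a(1) fin(2) by (intro vdeg_ge_card) auto
      moreover have "card {{a, c}, {c, nxt c}} = 2"
        using n[OF a(2)] n[OF a(3)] a(1) by (auto simp: card_insert_if doubleton_eq_iff)
      ultimately show "c \<in> D - deg_class 1" using a by (auto simp: deg_class_def)
    qed
  qed (use finD in simp)
  also have "\<dots> = card D - card (deg_class 1)"
    using fin by (intro card_Diff_subset) (auto simp: D deg_class_def)
  finally have 1: "card B \<le> card D - card (deg_class 1)" .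
  have 2: "card (deg_class 1) \<le> card D"
    using finD by (intro card_mono) (auto simp: D deg_class_def)
  have "card D = card (A \<union> B)" by (rule arg_cong[of _ _ card]) (auto simp: A_def B_def)
  also have "\<dots> = card A + card B"
    using finD by (intro card_Un_disjoint) (auto simp: A_def B_def)
  finally have 3: "card (deg_class 1) \<le> card A" using 1 2 by linarith
  have A: "a \<in> D" "vdeg E (nxt a) = 3" if "a \<in> A" for a
    using that n[of a] deg_le[of "nxt a"] by (auto simp: A_def D_def deg_class_def)
  have "inj_on (\<lambda>v. {v, nxt v}) A"
  proof (rule inj_onI)
    fix v w assume "v \<in> A" "w \<in> A" "{v, nxt v} = {w, nxt w}"
    then show "v = w" using A[of v] A[of w] D[of v] D[of w] by (auto simp: doubleton_eq_iff)
  qed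
  moreover have "(\<lambda>v. {v, nxt v}) ` A \<subseteq> type_edges E 1 3 \<union> type_edges E 2 3"
  proof
    fix e assume "e \<in> (\<lambda>v. {v, nxt v}) ` A"
    then obtain a where a: "a \<in> A" "e = {a, nxt a}" by blast
    have "vdeg E a = 1 \<or> vdeg E a = 2"
      using A(1)[OF a(1)] D[of a] deg_pos[of a] by auto
    moreover have "e \<in> type_edges E (vdeg E a) 3"
      using a A[OF a(1)] n[of a] unfolding type_edges_def by blast
    ultimately show "e \<in> type_edges E 1 3 \<union> type_edges E 2 3" by auto
  qed
  ultimately have "card A \<le> card (type_edges E 1 3 \<union> type_edges E 2 3)"
    using fin by (intro card_inj_on_le) auto
  also have "\<dots> \<le> x 1 3 + x 2 3" by (rule card_Un_le)
  finally show ?thesis using 3 class_sizes(1) by linarith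
qed

end

section \<open>Chemical graphs in terms of vertex and edge sets\<close>

lemma adj_uedges:
  assumes "pair_graph G"
  shows "adj (uedges G) = parcs G"
proof -
  interpret pair_graph G by fact
  have "{a, b} \<in> uedges G \<longleftrightarrow> (a, b) \<in> parcs G" for a b
    unfolding uedges_def mem_Collect_eq doubleton_eq_iff using arcs_symmetric by blast
  then show ?thesis by (simp add: adj_def)
qed

lemma deg_eq_vdeg:
  assumes "pair_graph G"
  shows "deg G v = vdeg (uedges G) v"
proof -
  interpret pair_graph G by fact
  have "bij_betw (\<lambda>e. {fst e, snd e}) {e \<in> parcs G. fst e = v} {e \<in> uedges G. v \<in> e}"
  proof (rule bij_betw_imageI)
    show "inj_on (\<lambda>e. {fst e, snd e}) {e \<in> parcs G. fst e = v}"
      by (rule inj_onI) (auto simp: doubleton_eq_iff prod_eq_iff)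
    show "(\<lambda>e. {fst e, snd e}) ` {e \<in> parcs G. fst e = v} = {e \<in> uedges G. v \<in> e}"
    proof (rule equalityI; rule subsetI)
      fix e assume "e \<in> (\<lambda>e. {fst e, snd e}) ` {e \<in> parcs G. fst e = v}"
      then obtain b where "e = {v, b}" "(v, b) \<in> parcs G" by force
      then show "e \<in> {e \<in> uedges G. v \<in> e}" unfolding uedges_def by blast
    next
      fix e assume "e \<in> {e \<in> uedges G. v \<in> e}"
      then obtain a b where ab: "e = {a, b}" "(a, b) \<in> parcs G" "v = a \<or> v = b"
        unfolding uedges_def by blast
      from ab(3) obtain w where w: "e = {v, w}" "(v, w) \<in> parcs G"
      proof
        assume "v = a"
        with ab that show thesis by simp
      next
        assume "v = b"
        then show thesis using that[of a] ab(1) arcs_symmetric[OF ab(2)]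
          by (simp add: insert_commute)
      qed
      then show "e \<in> (\<lambda>e. {fst e, snd e}) ` {e \<in> parcs G. fst e = v}"
        by (intro image_eqI[of _ _ "(v, w)"]) simp_all
    qed
  qed
  from bij_betw_same_card[OF this] show ?thesis
    by (simp add: deg_def vdeg_def out_degree_def out_arcs_def)
qed

lemma conn_graph_uedges:
  assumes "pair_graph G" "connected (with_proj G)"
  shows "conn_graph (pverts G) (uedges G)"
proof -
  interpret pair_graph G by fact
  have sc: "strongly_connected (with_proj G)"
    using symmetric_connected_imp_strongly_connected[OF sym_arcs assms(2)] .
  have "(u, v) \<in> (parcs G)\<^sup>*" if "u \<in> pverts G" "v \<in> pverts G" for u v
    using sc that reachable_rtranclI[of "with_proj G" u v] by (auto simp: strongly_connected_def)
  moreover have "e \<subseteq> pverts G \<and> card e = 2" if "e \<in> uedges G" for e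
  proof -
    obtain u v where "e = {u, v}" "(u, v) \<in> parcs G"
      using \<open>e \<in> uedges G\<close> unfolding uedges_def by blast
    then show ?thesis using wellformed' no_loops' by (auto simp: card_insert_if)
  qed
  ultimately show ?thesis
    using sc pair_finite_verts
    unfolding conn_graph_def adj_uedges[OF assms(1)] strongly_connected_def by auto
qed

lemma chemical_graph_subcubic:
  assumes "chemical_graph G"
  shows "subcubic_graph (pverts G) (uedges G)"
proof
  show "conn_graph (pverts G) (uedges G)"
    using assms conn_graph_uedges by (auto simp: chemical_graph_def)
  show "card (pverts G) \<ge> 3" using assms by (simp add: chemical_graph_def graph_order_def)
  show "vdeg (uedges G) v \<le> 3" if "v \<in> pverts G" for v
    using assms that deg_eq_vdeg[of G v] by (auto simp: chemical_graph_def)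
qed

definition graph_of :: "'a set \<Rightarrow> 'a set set \<Rightarrow> 'a pair_pre_digraph" where
  "graph_of V E = \<lparr>pverts = V, parcs = adj E\<rparr>"

lemma uedges_graph_of:
  assumes "conn_graph V E"
  shows "uedges (graph_of V E) = E"
proof -
  have "e \<in> {{u, v} |u v. {u, v} \<in> E}" if e: "e \<in> E" for e
  proof -
    obtain u v where "e = {u, v}" by (rule conn_graph_edge[OF assms e])
    with e show ?thesis by blast
  qed
  then show ?thesis by (auto simp: uedges_def graph_of_def adj_def)
qed

lemma pair_graph_graph_of:
  assumes "conn_graph V E"
  shows "pair_graph (graph_of V E)"
proof -
  have "adj E \<subseteq> V \<times> V" using conn_graph_doubleton[OF assms] by (auto simp: adj_def)
  then have "finite (adj E)"
    using conn_graph_finite(1)[OF assms] by (meson finite_SigmaI finite_subset)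
  then show ?thesis
    using conn_graph_finite(1)[OF assms] conn_graph_doubleton[OF assms]
    by unfold_locales
      (auto simp: graph_of_def adj_def symmetric_def insert_commute intro!: symI)
qed

lemma connected_graph_of:
  assumes "conn_graph V E"
  shows "connected (with_proj (graph_of V E))"
proof -
  interpret pair_graph "graph_of V E" using pair_graph_graph_of[OF assms] .
  have V: "V \<noteq> {}" and R: "\<And>u v. u \<in> V \<Longrightarrow> v \<in> V \<Longrightarrow> (u, v) \<in> (adj E)\<^sup>*"
    using assms by (simp_all add: conn_graph_def)
  have *: "pverts (graph_of V E) = V" "parcs (graph_of V E) = adj E"
    by (simp_all add: graph_of_def)
  have "u \<rightarrow>\<^sup>*\<^bsub>with_proj (graph_of V E)\<^esub> v" if "u \<in> V" "v \<in> V" for u v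
    using R that by (subst reachable_conv') (simp_all add: *)
  then show ?thesis
    unfolding connected_def strongly_connected_def
    using V by (simp add: reachable_mk_symmetric_eq[OF sym_arcs] *)
qed

section \<open>Building connected graphs\<close>

lemma conn_graphI:
  assumes "finite V" "V \<noteq> {}" "\<And>e. e \<in> E \<Longrightarrow> e \<subseteq> V" "\<And>e. e \<in> E \<Longrightarrow> card e = 2"
    "\<And>u v. u \<in> V \<Longrightarrow> v \<in> V \<Longrightarrow> (u, v) \<in> (adj E)\<^sup>*"
  shows "conn_graph V E"
  unfolding conn_graph_def using assms by blast

lemma conn_graphD:
  assumes "conn_graph V E"
  shows "finite V" "V \<noteq> {}" "e \<in> E \<Longrightarrow> e \<subseteq> V" "e \<in> E \<Longrightarrow> card e = 2"
    "u \<in> V \<Longrightarrow> v \<in> V \<Longrightarrow> (u, v) \<in> (adj E)\<^sup>*"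
  using assms unfolding conn_graph_def by blast+

lemma conn_graph_singleton: "conn_graph {v} {}"
  by (simp add: conn_graph_def)

lemma conn_graph_pendant:
  assumes "conn_graph V E" "u \<in> V" "w \<notin> V"
  shows "conn_graph (insert w V) (insert {u, w} E)"
proof -
  let ?R = "adj (insert {u, w} E)"
  have mono: "(adj E)\<^sup>* \<subseteq> ?R\<^sup>*" by (intro rtrancl_mono) (auto simp: adj_def)
  have uw: "(u, w) \<in> ?R" "(w, u) \<in> ?R" by (auto simp: adj_def insert_commute)
  have V: "(a, b) \<in> ?R\<^sup>*" if "a \<in> V" "b \<in> V" for a b
    using conn_graphD(5)[OF assms(1) that] mono by blast
  have "(a, u) \<in> ?R\<^sup>*" "(u, a) \<in> ?R\<^sup>*" if "a \<in> insert w V" for a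
    using that V[of a u] V[of u a] assms(2) uw by auto
  then have "(a, b) \<in> ?R\<^sup>*" if "a \<in> insert w V" "b \<in> insert w V" for a b
    using that by (meson rtrancl_trans)
  moreover have "e \<subseteq> insert w V \<and> card e = 2" if "e \<in> insert {u, w} E" for e
    using that conn_graphD(3,4)[OF assms(1), of e] assms(2,3) by (auto simp: card_2_iff)
  ultimately show ?thesis using conn_graphD(1)[OF assms(1)] by (intro conn_graphI) simp_all
qed

lemma conn_graph_chord:
  assumes "conn_graph V E" "u \<in> V" "v \<in> V" "u \<noteq> v"
  shows "conn_graph V (insert {u, v} E)"
proof -
  have "(adj E)\<^sup>* \<subseteq> (adj (insert {u, v} E))\<^sup>*" by (intro rtrancl_mono) (auto simp: adj_def)
  then have "(a, b) \<in> (adj (insert {u, v} E))\<^sup>*" if "a \<in> V" "b \<in> V" for a b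
    using conn_graphD(5)[OF assms(1) that] by blast
  moreover have "e \<subseteq> V \<and> card e = 2" if "e \<in> insert {u, v} E" for e
    using that conn_graphD(3,4)[OF assms(1), of e] assms(2-4) by auto
  ultimately show ?thesis using conn_graphD(1,2)[OF assms(1)] by (intro conn_graphI) simp_all
qed

lemma vdeg_empty [simp]: "vdeg {} v = 0"
  by (simp add: vdeg_def)

lemma vdeg_insert:
  assumes "finite E" "e \<notin> E"
  shows "vdeg (insert e E) v = vdeg E v + of_bool (v \<in> e)"
proof -
  have "{e' \<in> insert e E. v \<in> e'} = {e' \<in> E. v \<in> e'} \<union> (if v \<in> e then {e} else {})" by auto
  then show ?thesis using assms by (auto simp: vdeg_def)
qed

lemma fresh_vertex:
  assumes "conn_graph V E" "w \<notin> V"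
  shows "vdeg E w = 0" and "w \<in> e \<Longrightarrow> e \<notin> E"
proof -
  show *: "e \<notin> E" if "w \<in> e" for e using conn_graphD(3)[OF assms(1), of e] assms(2) that by blast
  have "{e \<in> E. w \<in> e} = {}" using * by blast
  then show "vdeg E w = 0" unfolding vdeg_def by (simp only: card.empty)
qed

lemma triangle:
  assumes "a \<noteq> b" "a \<noteq> c" "b \<noteq> c"
  shows "conn_graph {a, b, c} {{a, b}, {b, c}, {a, c}}"
proof -
  have "conn_graph {b, a} {{a, b}}"
    using conn_graph_pendant[OF conn_graph_singleton, of a a b] assms by simp
  then have "conn_graph {c, b, a} {{b, c}, {a, b}}"
    using conn_graph_pendant[of "{b, a}" _ b c] assms by simp
  then have "conn_graph {c, b, a} {{a, c}, {b, c}, {a, b}}"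
    using conn_graph_chord[of "{c, b, a}" _ a c] assms by simp
  then show ?thesis by (simp add: insert_commute)
qed

text \<open>
This is \<open>K4\<close> without the edge \<open>{a, d}\<close>.
\<close>

lemma diamond:
  assumes "distinct [a, b, c, d]"
  shows "conn_graph {a, b, c, d} {{a, b}, {b, c}, {a, c}, {b, d}, {c, d}}"
proof -
  have "conn_graph {d, a, b, c} {{b, d}, {a, b}, {b, c}, {a, c}}"
    using conn_graph_pendant[OF triangle, of a b c b d] assms by (simp add: eq_commute[of d])
  then have "conn_graph {d, a, b, c} {{c, d}, {b, d}, {a, b}, {b, c}, {a, c}}"
    using conn_graph_chord[of "{d, a, b, c}" _ c d] assms by simp
  then show ?thesis by (simp add: insert_commute)
qed

lemma card_4_obtain:
  assumes "card W = 4"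
  obtains a b c d where "W = {a, b, c, d}" "distinct [a, b, c, d]"
proof -
  have "finite W" using assms by (metis card.infinite zero_neq_numeral)
  then obtain xs where xs: "set xs = W" "distinct xs" using finite_distinct_list by blast
  then have "length xs = 4" using assms distinct_card by metis
  then obtain a b c d where "xs = [a, b, c, d]"
    by (auto simp: numeral_eq_Suc length_Suc_conv)
  with xs that show thesis by auto
qed

section \<open>Subcubic cores\<close>

lemma card_pos_obtain:
  assumes "card W = k" "0 < k"
  obtains w where "w \<in> W"
proof -
  have "W \<noteq> {}" using assms by auto
  then show thesis using that by blast
qed

text \<open>
Cores in which only two vertices \<open>p\<close>, \<open>q\<close> miss one neighbour: start from \<open>K4\<close> minus an edge and add
rungs. A new rung \<open>{a, b}\<close> with \<open>a\<close> joined to \<open>p\<close> and \<open>b\<close> joined to \<open>q\<close> saturates \<open>p\<close> and \<open>q\<close> and makes \<open>a\<close> and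
\<open>b\<close> the free ends.
\<close>

lemma ladder_with_two_free_ends:
  assumes "card W = 2 * j + 4"
  shows "\<exists>E p q. conn_graph W E \<and> card E = 3 * j + 5 \<and> p \<in> W \<and> q \<in> W \<and> p \<noteq> q \<and>
    vdeg E p = 2 \<and> vdeg E q = 2 \<and> (\<forall>v\<in>W - {p, q}. vdeg E v = 3)"
  using assms
proof (induction j arbitrary: W)
  case 0
  then have "card W = 4" by simp
  then obtain a b c d where W: "W = {a, b, c, d}" "distinct [a, b, c, d]" by (rule card_4_obtain)
  define E where "E = {{a, b}, {b, c}, {a, c}, {b, d}, {c, d}}"
  have ne: "a \<noteq> b" "a \<noteq> c" "a \<noteq> d" "b \<noteq> c" "b \<noteq> d" "c \<noteq> d"
    "b \<noteq> a" "c \<noteq> a" "d \<noteq> a" "c \<noteq> b" "d \<noteq> b" "d \<noteq> c" using W(2) by auto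
  have deg: "vdeg E a = 2" "vdeg E d = 2" "vdeg E b = 3" "vdeg E c = 3"
    using ne by (simp_all add: E_def vdeg_insert doubleton_eq_iff)
  have "card E = 5" using ne by (simp add: E_def doubleton_eq_iff)
  moreover have "conn_graph W E" using diamond[OF W(2)] W(1) by (simp add: E_def)
  moreover have "\<forall>v\<in>W - {a, d}. vdeg E v = 3" using W(1) by (auto simp: deg)
  moreover have "a \<in> W" "d \<in> W" "a \<noteq> d" using W by auto
  ultimately show ?case using deg(1,2) by (intro exI[of _ E] exI[of _ a] exI[of _ d]) simp
next
  case (Suc j)
  then have fW: "finite W" by (metis card.infinite add_is_0 zero_neq_numeral)
  obtain a where a: "a \<in> W" using card_pos_obtain[OF Suc.prems] by auto
  then have ca: "card (W - {a}) = 2 * j + 5" using Suc.prems fW by simp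
  then obtain b where b: "b \<in> W - {a}" using card_pos_obtain[OF ca] by auto
  define U where "U = W - {a} - {b}"
  have U: "W = insert b (insert a U)" "a \<notin> U" "b \<notin> U" "a \<noteq> b" using a b by (auto simp: U_def)
  have "card U = 2 * j + 4" using ca b fW by (simp add: U_def)
  from Suc.IH[OF this] obtain E p q where E: "conn_graph U E" "card E = 3 * j + 5"
    "p \<in> U" "q \<in> U" "p \<noteq> q" "vdeg E p = 2" "vdeg E q = 2" "\<forall>v\<in>U - {p, q}. vdeg E v = 3"
    by blast
  define E' where "E' = insert {a, b} (insert {q, b} (insert {p, a} E))"
  have ne: "p \<noteq> a" "p \<noteq> b" "q \<noteq> a" "q \<noteq> b" using E(3,4) U by auto
  have fE: "finite E" using conn_graph_finite[OF E(1)] by simp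
  have new: "{p, a} \<notin> E" "{q, b} \<notin> insert {p, a} E" "{a, b} \<notin> insert {q, b} (insert {p, a} E)"
    using fresh_vertex(2)[OF E(1) U(2)] fresh_vertex(2)[OF E(1) U(3)] ne E(5) U(4)
    by (auto simp: doubleton_eq_iff)
  have deg: "vdeg E' v = vdeg E v + of_bool (v = p \<or> v = a) + of_bool (v = q \<or> v = b)
    + of_bool (v = a \<or> v = b)" for v
    unfolding E'_def by (simp only: vdeg_insert fE new finite_insert not_False_eq_True) simp
  have "card E' = 3 * Suc j + 5"
    unfolding E'_def by (simp only: card_insert_disjoint fE new finite_insert not_False_eq_True E(2)) simp
  moreover have "conn_graph W E'"
    unfolding E'_def U(1) using E U ne
    by (intro conn_graph_chord conn_graph_pendant) auto
  moreover have "vdeg E' a = 2" "vdeg E' b = 2"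
    using ne U E(5) fresh_vertex(1)[OF E(1)] by (simp_all add: deg)
  moreover have "\<forall>v\<in>W - {a, b}. vdeg E' v = 3"
  proof
    fix v assume v: "v \<in> W - {a, b}"
    then have nv: "v \<noteq> a" "v \<noteq> b" "v \<in> U" using U by auto
    consider "v = p" | "v = q" | "v \<in> U - {p, q}" using nv by blast
    then show "vdeg E' v = 3"
      by cases (use E nv in \<open>simp_all add: deg\<close>)
  qed
  moreover have "a \<in> W" "b \<in> W" using U by auto
  ultimately show ?case using U(4) by blast
qed

lemma vdeg_le_card:
  assumes "finite E"
  shows "vdeg E v \<le> card E"
  unfolding vdeg_def using assms by (intro card_mono) auto

lemma deficient_vertex:
  assumes "conn_graph V E" "2 * card E < 3 * card V"
  obtains u where "u \<in> V" "vdeg E u < 3"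
proof -
  have "\<exists>u\<in>V. vdeg E u < 3"
  proof (rule ccontr)
    assume "\<not> (\<exists>u\<in>V. vdeg E u < 3)"
    then have "(\<Sum>v\<in>V. 3) \<le> (\<Sum>v\<in>V. vdeg E v)" by (intro sum_mono) auto
    then show False using degree_sum[OF assms(1)] assms(2) by simp
  qed
  with that show thesis by blast
qed

text \<open>
The number \<open>3 * N - 2 * k\<close> of missing neighbours is at least one. If it is one, join the two free ends of
a ladder to a new vertex. Otherwise hang a vertex on a deficient vertex of a core with one vertex and
one edge less, which lowers that number by one. The triangle and \<open>K4\<close> minus an edge are separate
starting points because their predecessors \<open>(2, 2)\<close> and \<open>(3, 4)\<close> do not exist.
\<close>

lemma subcubic_core:
  assumes "card W = N" "N \<le> k + 1" "2 * k < 3 * N" "(N, k) \<notin> {(1, 1), (2, 2), (3, 4)}"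
  shows "\<exists>E. conn_graph W E \<and> card E = k \<and> (\<forall>v\<in>W. vdeg E v \<le> 3)"
  using assms
proof (induction N arbitrary: W k)
  case 0
  then show ?case by simp
next
  case (Suc N)
  have fW: "finite W" using Suc.prems(1) by (metis card.infinite nat.distinct(1))
  have "2 * k + 1 = 3 * Suc N \<or> 2 * k + 1 < 3 * Suc N" using Suc.prems(3) by linarith
  then consider "N = 0" | "N = 2" "k = 3" | "N = 3" "k = 5" | "N \<noteq> 0" "2 * k + 1 = 3 * Suc N"
    | "N \<noteq> 0" "2 * k + 1 < 3 * Suc N" "\<not> (N = 2 \<and> k = 3)" "\<not> (N = 3 \<and> k = 5)"
    by blast
  then show ?case
  proof cases
    case 1
    then have "card W = 1" using Suc.prems(1) by simp
    then obtain v where "W = {v}" by (rule card_1_singletonE)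
    moreover have "k = 0" using Suc.prems(3,4) 1 by auto
    ultimately show ?thesis using conn_graph_singleton[of v] by (intro exI[of _ "{}"]) simp
  next
    case 2
    then have "card W = 3" using Suc.prems(1) by simp
    then obtain a b c where W: "W = {a, b, c}" "a \<noteq> b" "a \<noteq> c" "b \<noteq> c"
      unfolding card_3_iff by blast
    define E where "E = {{a, b}, {b, c}, {a, c}}"
    have E: "conn_graph W E" using triangle[OF W(2-4)] W(1) by (simp add: E_def)
    moreover have "card E = 3" using W(2-4) by (simp add: E_def doubleton_eq_iff)
    moreover from this have "vdeg E v \<le> 3" for v
      using vdeg_le_card[OF conn_graph_finite(2)[OF E], of v] by simp
    ultimately show ?thesis using 2 by blast
  next
    case 3
    then have "card W = 2 * 0 + 4" using Suc.prems(1) by simp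
    from ladder_with_two_free_ends[OF this] obtain E p q where E: "conn_graph W E" "card E = 3 * 0 + 5"
      "p \<in> W" "q \<in> W" "p \<noteq> q" "vdeg E p = 2" "vdeg E q = 2" "\<forall>v\<in>W - {p, q}. vdeg E v = 3"
      by blast
    have "vdeg E v \<le> 3" if "v \<in> W" for v
    proof -
      consider "v = p" | "v = q" | "v \<in> W - {p, q}" using \<open>v \<in> W\<close> by blast
      then show ?thesis by cases (use E in simp_all)
    qed
    moreover have "card E = k" using E(2) 3 by simp
    ultimately show ?thesis using E(1) by blast
  next
    case 4
    define j where "j = k div 3 - 2"
    have j: "N = 2 * j + 4" "k = 3 * j + 7"
    proof -
      have "even N" using 4(2) by presburger
      then obtain i where i: "N = 2 * i" by (rule evenE)
      then have "k = 3 * i + 1" using 4(2) by simp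
      moreover have "i \<noteq> 0" using 4(1) i by simp
      moreover have "i \<noteq> 1" using Suc.prems(4) i \<open>k = 3 * i + 1\<close> by auto
      ultimately have "2 \<le> i" "k div 3 = i" by simp_all
      with i \<open>k = 3 * i + 1\<close> show "N = 2 * j + 4" "k = 3 * j + 7" by (simp_all add: j_def)
    qed
    obtain w where w: "w \<in> W" using card_pos_obtain[OF Suc.prems(1)] by auto
    define U where "U = W - {w}"
    have U: "W = insert w U" "w \<notin> U" "card U = 2 * j + 4"
      using w Suc.prems(1) fW j by (auto simp: U_def)
    from ladder_with_two_free_ends[OF U(3)] obtain E p q where E: "conn_graph U E" "card E = 3 * j + 5"
      "p \<in> U" "q \<in> U" "p \<noteq> q" "vdeg E p = 2" "vdeg E q = 2" "\<forall>v\<in>U - {p, q}. vdeg E v = 3"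
      by blast
    define E' where "E' = insert {q, w} (insert {p, w} E)"
    have ne: "p \<noteq> w" "q \<noteq> w" using E(3,4) U by auto
    have fE: "finite E" using conn_graph_finite[OF E(1)] by simp
    have new: "{p, w} \<notin> E" "{q, w} \<notin> insert {p, w} E"
      using fresh_vertex(2)[OF E(1) U(2)] ne E(5) by (auto simp: doubleton_eq_iff)
    have deg: "vdeg E' v = vdeg E v + of_bool (v = p \<or> v = w) + of_bool (v = q \<or> v = w)" for v
      unfolding E'_def by (simp only: vdeg_insert fE new finite_insert not_False_eq_True) simp
    have "card E' = k"
      unfolding E'_def
      by (simp only: card_insert_disjoint fE new finite_insert not_False_eq_True E(2) j)
    moreover have "conn_graph W E'"
      unfolding E'_def U(1) using E U ne by (intro conn_graph_chord conn_graph_pendant) auto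
    moreover have "\<forall>v\<in>W. vdeg E' v \<le> 3"
    proof
      fix v assume v: "v \<in> W"
      consider "v = w" | "v = p" | "v = q" | "v \<noteq> w" "v \<in> U - {p, q}" using v U(1,2) by blast
      then show "vdeg E' v \<le> 3"
        by cases (use E ne fresh_vertex(1)[OF E(1) U(2)] in \<open>simp_all add: deg\<close>)
    qed
    ultimately show ?thesis by blast
  next
    case 5
    obtain w where w: "w \<in> W" using card_pos_obtain[OF Suc.prems(1)] by auto
    define U where "U = W - {w}"
    have U: "W = insert w U" "w \<notin> U" "card U = N"
      using w Suc.prems(1) fW by (auto simp: U_def)
    have k: "k = Suc (k - 1)" using 5 Suc.prems(2) by simp
    have "N \<le> k - 1 + 1" "2 * (k - 1) < 3 * N" "(N, k - 1) \<notin> {(1, 1), (2, 2), (3, 4)}"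
      using 5 Suc.prems k by auto
    from Suc.IH[OF U(3) this] obtain E where E: "conn_graph U E" "card E = k - 1"
      "\<forall>v\<in>U. vdeg E v \<le> 3" by blast
    obtain u where u: "u \<in> U" "vdeg E u < 3"
      using deficient_vertex[OF E(1)] E(2) U(3) \<open>2 * (k - 1) < 3 * N\<close> by metis
    have new: "{u, w} \<notin> E" using fresh_vertex(2)[OF E(1) U(2)] by auto
    have fE: "finite E" using conn_graph_finite[OF E(1)] by simp
    have "conn_graph W (insert {u, w} E)"
      unfolding U(1) using E(1) u(1) U(2) by (rule conn_graph_pendant)
    moreover have "card (insert {u, w} E) = k" using new fE E(2) k by simp
    moreover have "\<forall>v\<in>W. vdeg (insert {u, w} E) v \<le> 3"
    proof
      fix v assume "v \<in> W"
      then consider "v = w" | "v = u" | "v \<noteq> w" "v \<noteq> u" "v \<in> U" using U(1) by blast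
      then show "vdeg (insert {u, w} E) v \<le> 3"
        unfolding vdeg_insert[OF fE new]
        by cases (use fresh_vertex(1)[OF E(1) U(2)] u(2) E(3) in simp_all)
    qed
    ultimately show ?thesis by blast
  qed
qed

section \<open>Hanging paths on a core\<close>

text \<open>
A stage in the saturation of the prospective set \<open>C\<close> of vertices of degree three. The vertices outside
\<open>C\<close> have degree at most two already, and leaves next to \<open>C\<close> occur only along the edges of \<open>X\<close>. Once every
vertex of \<open>C\<close> has degree three, \<open>X\<close> therefore contains all edges of type \<open>13\<close>.
\<close>

definition legged :: "'a set \<Rightarrow> 'a set set \<Rightarrow> 'a set \<Rightarrow> 'a set set \<Rightarrow> bool" where
  "legged C X V E \<longleftrightarrow> conn_graph V E \<and> C \<subseteq> V \<and> (\<forall>c\<in>C. vdeg E c \<le> 3) \<and>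
     (\<forall>v\<in>V - C. vdeg E v \<le> 2) \<and>
     (\<forall>c\<in>C. \<forall>v\<in>V - C. {c, v} \<in> E \<longrightarrow> vdeg E v = 1 \<longrightarrow> {c, v} \<in> X)"

lemma legged_core:
  assumes "conn_graph V E" "\<forall>v\<in>V. vdeg E v \<le> 3"
  shows "legged V X V E"
  using assms by (simp add: legged_def)

lemma legged_attach:
  assumes L: "legged C X V E" and c: "c \<in> C" "vdeg E c < 3"
    and new: "a \<notin> V" "b \<notin> V" "a \<noteq> b"
  defines "E' \<equiv> insert {a, b} (insert {c, a} E)"
  shows "legged C X (insert b (insert a V)) E'"
    and "card E' = card E + 2"
    and "vdeg E' v = vdeg E v + of_bool (v = c \<or> v = a) + of_bool (v = a \<or> v = b)"
    and "vdeg E' b = 1"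
proof -
  have G: "conn_graph V E" and CV: "C \<subseteq> V" using L by (simp_all add: legged_def)
  have cV: "c \<in> V" using c CV by blast
  have ne: "c \<noteq> a" "c \<noteq> b" "a \<notin> C" "b \<notin> C" using cV new CV by blast+
  have fE: "finite E" using conn_graph_finite[OF G] by simp
  have fresh: "{c, a} \<notin> E" "{a, b} \<notin> insert {c, a} E"
    using fresh_vertex(2)[OF G new(1)] ne new(3) by (auto simp: doubleton_eq_iff)
  show deg: "vdeg E' v = vdeg E v + of_bool (v = c \<or> v = a) + of_bool (v = a \<or> v = b)" for v
    unfolding E'_def by (simp only: vdeg_insert fE fresh finite_insert not_False_eq_True) simp
  have out: "vdeg E a = 0" "vdeg E b = 0" using fresh_vertex(1)[OF G] new by auto
  then show "vdeg E' b = 1" using ne new(3) by (simp add: deg)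
  show "card E' = card E + 2" unfolding E'_def using fE fresh by simp
  have G': "conn_graph (insert b (insert a V)) E'"
    unfolding E'_def using conn_graph_pendant[OF conn_graph_pendant[OF G cV new(1)]] new by simp
  have "vdeg E' x \<le> 3" if "x \<in> C" for x
  proof -
    have "x \<noteq> a" "x \<noteq> b" using that ne by auto
    then show ?thesis using L that c unfolding legged_def by (simp add: deg)
  qed
  moreover have "vdeg E' v \<le> 2" if "v \<in> insert b (insert a V) - C" for v
  proof (cases "v \<in> V")
    case True
    then have "v \<noteq> a" "v \<noteq> b" "v \<noteq> c" using new that c by auto
    then show ?thesis using L that True unfolding legged_def by (simp add: deg)
  next
    case False
    then show ?thesis using that out ne new(3) by (auto simp: deg)
  qed
  moreover have "{x, v} \<in> X"
    if x: "x \<in> C" and v: "v \<in> insert b (insert a V) - C" and e: "{x, v} \<in> E'" "vdeg E' v = 1"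
    for x v
  proof -
    have "x \<noteq> a" "x \<noteq> b" using x ne by auto
    moreover have "v \<noteq> a" using e(2) out ne new(3) by (auto simp: deg)
    moreover have "v \<noteq> c" using v c by auto
    ultimately have vE: "{x, v} \<in> E" using e(1) by (auto simp: E'_def doubleton_eq_iff)
    then have "v \<in> V" using conn_graph_doubleton[OF G vE] by simp
    moreover from this have "v \<noteq> b" using new by blast
    with e(2) \<open>v \<noteq> a\<close> \<open>v \<noteq> c\<close> have "vdeg E v = 1" by (simp add: deg)
    ultimately show ?thesis using L x v vE unfolding legged_def by blast
  qed
  ultimately show "legged C X (insert b (insert a V)) E'"
    unfolding legged_def using G' CV by blast
qed

text \<open>
Each hanging path of length two lowers the total deficiency \<open>t\<close> of \<open>C\<close> by one and uses two new vertices.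
The degrees outside \<open>C\<close> are recorded as unchanged so that the end of the first path is still a leaf
after the remaining ones have been attached.
\<close>

lemma legged_fill:
  assumes "legged C X V E" "(\<Sum>c\<in>C. 3 - vdeg E c) = t" "finite W" "card W = 2 * t" "W \<inter> V = {}"
  shows "\<exists>E'. legged C X (V \<union> W) E' \<and> E \<subseteq> E' \<and> card E' = card E + 2 * t \<and>
    (\<forall>c\<in>C. vdeg E' c = 3) \<and> (\<forall>v\<in>V - C. vdeg E' v = vdeg E v) \<and>
    (t \<noteq> 0 \<longrightarrow> (\<exists>b\<in>W. vdeg E' b = 1))"
  using assms
proof (induction t arbitrary: V E W)
  case 0
  have "finite C" using 0(1) conn_graph_finite(1) finite_subset unfolding legged_def by blast
  then have "vdeg E c = 3" if "c \<in> C" for c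
    using 0(1,2) that unfolding legged_def by (force intro: le_antisym)
  moreover have "W = {}" using 0(3,4) by simp
  ultimately show ?case using 0(1) by (intro exI[of _ E]) simp
next
  case (Suc t)
  have G: "conn_graph V E" and CV: "C \<subseteq> V" using Suc.prems(1) by (simp_all add: legged_def)
  have fC: "finite C" using conn_graph_finite(1)[OF G] CV finite_subset by blast
  have "\<exists>c\<in>C. 3 - vdeg E c \<noteq> 0"
    using Suc.prems(2) by (metis sum.neutral nat.distinct(1))
  then obtain c where c: "c \<in> C" "vdeg E c < 3" by auto
  obtain a where a: "a \<in> W" using card_pos_obtain[OF Suc.prems(4)] by auto
  then have ca: "card (W - {a}) = Suc (2 * t)" using Suc.prems(3,4) by simp
  then obtain b where b: "b \<in> W - {a}" using card_pos_obtain[OF ca] by auto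
  define W' where "W' = W - {a} - {b}"
  have W': "finite W'" "card W' = 2 * t" using ca b Suc.prems(3) by (simp_all add: W'_def)
  have ab: "a \<notin> V" "b \<notin> V" "a \<noteq> b" using a b Suc.prems(5) by auto
  define V1 where "V1 = insert b (insert a V)"
  define E1 where "E1 = insert {a, b} (insert {c, a} E)"
  note at = legged_attach[OF Suc.prems(1) c ab, folded E1_def V1_def]
  have ne: "a \<notin> C" "b \<notin> C" using ab CV by auto
  have "(\<Sum>x\<in>C. 3 - vdeg E1 x) = t"
  proof -
    have "(\<Sum>x\<in>C - {c}. 3 - vdeg E1 x) = (\<Sum>x\<in>C - {c}. 3 - vdeg E x)"
      using ne by (intro sum.cong) (auto simp: at(3))
    moreover have "3 - vdeg E c = Suc (3 - vdeg E1 c)"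
      using c ne by (auto simp: at(3))
    ultimately show ?thesis
      using Suc.prems(2) sum.remove[OF fC c(1), of "\<lambda>x. 3 - vdeg E x"]
        sum.remove[OF fC c(1), of "\<lambda>x. 3 - vdeg E1 x"] by simp
  qed
  moreover have "W' \<inter> V1 = {}" using Suc.prems(5) by (auto simp: W'_def V1_def)
  ultimately obtain E' where E': "legged C X (V1 \<union> W') E'" "E1 \<subseteq> E'"
    "card E' = card E1 + 2 * t" "\<forall>c\<in>C. vdeg E' c = 3" "\<forall>v\<in>V1 - C. vdeg E' v = vdeg E1 v"
    using Suc.IH[OF at(1) _ W'] by blast
  have "V1 \<union> W' = V \<union> W" using a b by (auto simp: V1_def W'_def)
  moreover have "E \<subseteq> E'" using E'(2) by (auto simp: E1_def)
  moreover have "card E' = card E + 2 * Suc t" using E'(3) at(2) by simp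
  moreover have "vdeg E' v = vdeg E v" if "v \<in> V - C" for v
  proof -
    have "v \<noteq> a" "v \<noteq> b" "v \<noteq> c" using that ab c by auto
    then show ?thesis using E'(5) that at(3)[of v] by (simp add: V1_def)
  qed
  moreover have "vdeg E' b = 1" using E'(5) ne at(4) by (simp add: V1_def)
  ultimately show ?case using E'(1,4) b by (intro exI[of _ E']) auto
qed

lemma legged_extend:
  assumes "legged C X V E" "b \<in> V - C" "vdeg E b = 1" "finite W" "card W = r" "W \<inter> V = {}"
  shows "\<exists>E'. legged C X (V \<union> W) E' \<and> E \<subseteq> E' \<and> card E' = card E + r \<and>
    (\<forall>c\<in>C. vdeg E' c = vdeg E c)"
  using assms
proof (induction r arbitrary: V E W b)
  case 0
  then show ?case by (intro exI[of _ E]) simp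
next
  case (Suc r)
  have G: "conn_graph V E" and CV: "C \<subseteq> V" using Suc.prems(1) by (simp_all add: legged_def)
  obtain w where w: "w \<in> W" using card_pos_obtain[OF Suc.prems(5)] by auto
  define W' where "W' = W - {w}"
  have W': "finite W'" "card W' = r" "W = insert w W'" "w \<notin> W'"
    using w Suc.prems(4,5) by (auto simp: W'_def)
  define E1 where "E1 = insert {b, w} E"
  have wV: "w \<notin> V" using w Suc.prems(6) by auto
  have fresh: "{b, w} \<notin> E" using fresh_vertex(2)[OF G wV] by simp
  have fE: "finite E" using conn_graph_finite[OF G] by simp
  have ne: "w \<notin> C" "w \<noteq> b" "b \<notin> C" using wV CV Suc.prems(2) by auto
  have deg: "vdeg E1 v = vdeg E v + of_bool (v = b \<or> v = w)" for v
    unfolding E1_def by (simp only: vdeg_insert fE fresh not_False_eq_True) simp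
  have w0: "vdeg E w = 0" using fresh_vertex(1)[OF G wV] .
  have "conn_graph (insert w V) E1"
    unfolding E1_def using conn_graph_pendant[OF G _ wV] Suc.prems(2) by simp
  moreover have C: "vdeg E1 c = vdeg E c" if "c \<in> C" for c
  proof -
    have "c \<noteq> b" "c \<noteq> w" using that ne by auto
    then show ?thesis by (simp add: deg)
  qed
  moreover have "vdeg E1 v \<le> 2" if "v \<in> insert w V - C" for v
  proof (cases "v = b \<or> v = w")
    case True
    then show ?thesis using w0 Suc.prems(3) by (auto simp: deg)
  next
    case False
    then show ?thesis using that Suc.prems(1) unfolding legged_def by (simp add: deg)
  qed
  moreover have "{c, v} \<in> X"
    if c: "c \<in> C" and v: "v \<in> insert w V - C" and e: "{c, v} \<in> E1" "vdeg E1 v = 1" for c v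
  proof -
    have cn: "c \<noteq> b" "c \<noteq> w" using c ne by auto
    then have vE: "{c, v} \<in> E" using e(1) by (auto simp: E1_def doubleton_eq_iff)
    then have "v \<in> V" using conn_graph_doubleton[OF G vE] by simp
    moreover have "v \<noteq> b" using e(2) Suc.prems(3) by (auto simp: deg)
    moreover have "v \<noteq> w" using \<open>v \<in> V\<close> wV by auto
    ultimately have "vdeg E v = 1" using e(2) by (simp add: deg)
    then show ?thesis using Suc.prems(1) c v vE \<open>v \<in> V\<close> unfolding legged_def by blast
  qed
  ultimately have L1: "legged C X (insert w V) E1"
    using Suc.prems(1) unfolding legged_def by (metis (no_types, lifting) subset_insertI2)
  have "w \<in> insert w V - C" "vdeg E1 w = 1" "W' \<inter> insert w V = {}"
    using ne w0 W' Suc.prems(6) by (auto simp: deg)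
  from Suc.IH[OF L1 this(1,2) W'(1,2) this(3)] obtain E' where E':
    "legged C X (insert w V \<union> W') E'" "E1 \<subseteq> E'" "card E' = card E1 + r"
    "\<forall>c\<in>C. vdeg E' c = vdeg E1 c" by blast
  have "insert w V \<union> W' = V \<union> W" using W'(3) by auto
  moreover have "E \<subseteq> E'" using E'(2) by (auto simp: E1_def)
  moreover have "card E' = card E + Suc r" using E'(3) fE fresh by (simp add: E1_def)
  ultimately show ?case using E'(1,4) C by (intro exI[of _ E']) simp
qed

text \<open>
The \<open>r\<close> vertices that are left over after all deficiencies have been filled lengthen a hanging
path, which exists when \<open>t\<close> is positive.
\<close>

lemma legged_complete:
  assumes L: "legged C X V E" and t: "(\<Sum>c\<in>C. 3 - vdeg E c) = t"
    and U: "finite U" "V \<subseteq> U" "card U = card V + 2 * t + r" and r: "r \<noteq> 0 \<Longrightarrow> t \<noteq> 0"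
  shows "\<exists>E'. legged C X U E' \<and> E \<subseteq> E' \<and> card E' = card E + 2 * t + r \<and> (\<forall>c\<in>C. vdeg E' c = 3)"
proof -
  have fV: "finite V" using U finite_subset by blast
  have "card (U - V) = 2 * t + r" using U fV by (simp add: card_Diff_subset)
  then obtain W where W: "W \<subseteq> U - V" "card W = 2 * t"
    by (metis obtain_subset_with_card_n le_add1)
  have fW: "finite W" using W U(1) finite_subset by blast
  have "W \<inter> V = {}" using W by auto
  from legged_fill[OF L t fW W(2) this] obtain E1 where E1: "legged C X (V \<union> W) E1" "E \<subseteq> E1"
    "card E1 = card E + 2 * t" "\<forall>c\<in>C. vdeg E1 c = 3" "t \<noteq> 0 \<longrightarrow> (\<exists>b\<in>W. vdeg E1 b = 1)"
    by blast
  define R where "R = U - V - W"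
  have R: "finite R" "R \<inter> (V \<union> W) = {}" "V \<union> W \<union> R = U" using U W by (auto simp: R_def)
  have cR: "card R = r"
    using card_Diff_subset[OF fW W(1)] \<open>card (U - V) = _\<close> W(2) by (simp add: R_def)
  show ?thesis
  proof (cases "r = 0")
    case True
    then have "V \<union> W = U" using R cR by simp
    then show ?thesis using E1 True by (intro exI[of _ E1]) simp
  next
    case False
    then obtain b where b: "b \<in> W" "vdeg E1 b = 1" using r E1(5) by blast
    have "C \<subseteq> V" using L by (simp add: legged_def)
    then have "b \<in> V \<union> W - C" using b W by auto
    from legged_extend[OF E1(1) this b(2) R(1) cR R(2)] obtain E' where E':
      "legged C X (V \<union> W \<union> R) E'" "E1 \<subseteq> E'" "card E' = card E1 + r"
      "\<forall>c\<in>C. vdeg E' c = vdeg E1 c" by blast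
    then show ?thesis using E1 R(3) by (intro exI[of _ E']) auto
  qed
qed

section \<open>The index as an integer optimization problem\<close>

definition score :: "'a pair_pre_digraph \<Rightarrow> int" where
  "score G = 217 * int (edge_count G 3 3) - 296 * int (edge_count G 1 3)"

lemma chemical_graph_pair_graph: "chemical_graph G \<Longrightarrow> pair_graph G"
  by (simp add: chemical_graph_def)

lemma edge_count_type_edges:
  "pair_graph G \<Longrightarrow> edge_count G i j = card (type_edges (uedges G) i j)"
  by (simp add: edge_count_def type_edges_def deg_eq_vdeg)

lemma size_by_types:
  assumes "chemical_graph G"
  shows "graph_size G = edge_count G 1 2 + edge_count G 1 3 + edge_count G 2 2
    + edge_count G 2 3 + edge_count G 3 3"
proof -
  interpret subcubic_graph "pverts G" "uedges G" using assms by (rule chemical_graph_subcubic)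
  show ?thesis
    using size_eq unfolding graph_size_def edge_count_type_edges[OF chemical_graph_pair_graph[OF assms]] .
qed

text \<open>
The weights are the differences of \<open>729/64\<close> and \<open>27/8\<close> from the common coefficient \<open>8\<close>, times \<open>64\<close>.
\<close>

lemma aZagreb_score:
  assumes "chemical_graph G"
  shows "aZagreb G = 8 * real (graph_size G) + real_of_int (score G) / 64"
  unfolding size_by_types[OF assms] aZagreb_def degree_based_index_def score_def
  by (simp add: power3_eq_cube field_simps)

lemma maximizes_iff_score:
  fixes G :: "'a pair_pre_digraph"
  assumes G: "chemical_graph G"
    and le: "\<And>H :: 'a pair_pre_digraph. chemical_graph H \<Longrightarrow> graph_order H = graph_order G \<Longrightarrow>
      graph_size H = graph_size G \<Longrightarrow> score H \<le> s"
    and ge: "\<exists>H :: 'a pair_pre_digraph. chemical_graph H \<and> graph_order H = graph_order G \<and>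
      graph_size H = graph_size G \<and> s \<le> score H"
  shows "maximizes aZagreb G \<longleftrightarrow> score G = s"
proof
  obtain H :: "'a pair_pre_digraph" where H: "chemical_graph H" "graph_order H = graph_order G" "graph_size H = graph_size G"
    "s \<le> score H" using ge by blast
  assume "maximizes aZagreb G"
  then have "aZagreb H \<le> aZagreb G" using H unfolding maximizes_def by blast
  then have "score H \<le> score G" using aZagreb_score[OF G] aZagreb_score[OF H(1)] H(3) by simp
  then show "score G = s" using H(4) le[OF G] by simp
next
  assume s: "score G = s"
  have "aZagreb H \<le> aZagreb G"
    if "chemical_graph H" "graph_order H = graph_order G" "graph_size H = graph_size G"
    for H :: "'a pair_pre_digraph"
    using le[OF that] s aZagreb_score[OF that(1)] aZagreb_score[OF G] that(3) by simp
  then show "maximizes aZagreb G" using G unfolding maximizes_def by blast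
qed

text \<open>
All that the upper bounds use about a chemical graph; \<open>p\<close> is the number of vertices of degree three.
The bounds on \<open>e\<close> for \<open>p\<close> from \<open>1\<close> to \<open>3\<close> are the instances of \<open>e \<le> (p choose 2)\<close> that matter.
\<close>

lemma chemical_graph_constraints:
  assumes G: "chemical_graph G" and v: "edge_vector G = (a, b, c, d, e)"
  defines "n \<equiv> int (graph_order G)" and "m \<equiv> int (graph_size G)"
  obtains p :: int where
    "m = a + b + c + d + e"
    "6 * n = 9 * a + 8 * b + 6 * c + 5 * d + 4 * e"
    "even (a + d)"
    "3 * p = b + d + 2 * e"
    "p \<noteq> 0 \<longrightarrow> a \<le> d"
    "p = 1 \<longrightarrow> e = 0" "p = 2 \<longrightarrow> e \<le> 1" "p = 3 \<longrightarrow> e \<le> 3"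
    "n \<le> m + 1" "2 * m \<le> 3 * n - 3" "7 \<le> n"
    "0 \<le> a" "0 \<le> b" "0 \<le> c" "0 \<le> d" "0 \<le> e"
proof -
  interpret S: subcubic_graph "pverts G" "uedges G" using G by (rule chemical_graph_subcubic)
  have x: "a = int (edge_count G 1 2)" "b = int (edge_count G 1 3)" "c = int (edge_count G 2 2)"
    "d = int (edge_count G 2 3)" "e = int (edge_count G 3 3)"
    using v by (simp_all add: edge_vector_def)
  note ec = edge_count_type_edges[OF chemical_graph_pair_graph[OF G]]
  let ?p = "card (S.deg_class 3)"
  have cl: "card (S.deg_class 1) = edge_count G 1 2 + edge_count G 1 3"
    "2 * card (S.deg_class 2) = edge_count G 1 2 + 2 * edge_count G 2 2 + edge_count G 2 3"
    "3 * ?p = edge_count G 1 3 + edge_count G 2 3 + 2 * edge_count G 3 3"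
    using S.class_sizes unfolding ec by blast+
  have n: "graph_order G = card (S.deg_class 1) + card (S.deg_class 2) + ?p"
    using S.order_eq unfolding graph_order_def .
  have m: "graph_size G = edge_count G 1 2 + edge_count G 1 3 + edge_count G 2 2
    + edge_count G 2 3 + edge_count G 3 3" using size_by_types[OF G] .
  have "edge_count G 3 3 \<le> ?p choose 2" using S.cubic_edges_le unfolding ec .
  then have ch: "edge_count G 3 3 \<le> ?p * (?p - 1) div 2" by (simp only: choose_two)
  show thesis
  proof (rule that[of "int ?p"])
    show "m = a + b + c + d + e" unfolding m_def m x by simp
    show "6 * n = 9 * a + 8 * b + 6 * c + 5 * d + 4 * e"
      using cl n unfolding n_def x by linarith
    have "even (edge_count G 1 2 + edge_count G 2 3)" using cl(2) by presburger
    then show "even (a + d)" unfolding x by presburger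
    show "3 * int ?p = b + d + 2 * e" using cl(3) unfolding x by linarith
    show "int ?p \<noteq> 0 \<longrightarrow> a \<le> d"
    proof
      assume "int ?p \<noteq> 0"
      then have "S.deg_class 3 \<noteq> {}" by auto
      from S.leg_count[OF this] show "a \<le> d" unfolding x ec by simp
    qed
    show "int ?p = 1 \<longrightarrow> e = 0" "int ?p = 2 \<longrightarrow> e \<le> 1" "int ?p = 3 \<longrightarrow> e \<le> 3"
      using ch unfolding x by auto
    show "n \<le> m + 1"
      using card_vertices_le[OF S.conn] by (simp add: n_def m_def graph_order_def graph_size_def)
    have "real (2 * graph_size G + 3) \<le> real (3 * graph_order G)"
      using G unfolding chemical_graph_def by simp
    then have "2 * graph_size G + 3 \<le> 3 * graph_order G" by (simp only: of_nat_le_iff)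
    then show "2 * m \<le> 3 * n - 3" unfolding n_def m_def by linarith
    show "7 \<le> n" using G unfolding chemical_graph_def n_def by linarith
  qed (simp_all add: x)
qed

lemma three_times_div_three:
  fixes x z :: int
  shows "3 * ((x + 3 * z) div 3) + x mod 3 = x + 3 * z"
  using mult_div_mod_eq[of 3 "x + 3 * z"] by simp

lemma even_sum_half_diff:
  fixes a d :: int
  assumes "even (a + d)"
  shows "d = a + 2 * ((d - a) div 2)"
proof -
  have "even (d - a)" using assms by simp
  then have "2 * ((d - a) div 2) = d - a" by (rule dvd_mult_div_cancel)
  then show ?thesis by simp
qed

text \<open>
Write \<open>q\<close> and \<open>u\<close> for the quotient and remainder of \<open>7m - 6n\<close> by \<open>3\<close>, and \<open>2k\<close> for \<open>d - a\<close>. Then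
\<open>3 (q - e) = 4k + c - b - u\<close>, so three times the loss \<open>217 q - (217 e - 296 b)\<close> is
\<open>217 (4k + c - u) + 671 b\<close>. As \<open>u \<le> 2\<close>, this is positive for \<open>b \<ge> 1\<close>; for \<open>b = 0\<close> the left-hand side is a
multiple of \<open>3\<close> that is at least \<open>-2\<close>, hence nonnegative, and it vanishes only for \<open>k = 0\<close> and \<open>c = u\<close>.
If \<open>a > d\<close>, then no vertex has degree three and the graph is a path, with score \<open>0\<close>.
\<close>

lemma score_bound:
  assumes G: "chemical_graph G"
  defines "n \<equiv> int (graph_order G)" and "m \<equiv> int (graph_size G)"
  defines "s \<equiv> 217 * ((7 * m - 6 * n) div 3)"
  shows "score G \<le> s"
    and "score G = s \<Longrightarrow> edge_vector G =
        ((3 * n - 2 * m) div 3, 0, m mod 3, (3 * n - 2 * m) div 3, (7 * m - 6 * n) div 3) \<or>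
      (m + 1 = n \<and> n \<in> {7, 8, 9} \<and> edge_vector G = (2, 0, m - 2, 0, 0))"
proof -
  define q where "q = (7 * m - 6 * n) div 3"
  define u where "u = m mod 3"
  have u: "0 \<le> u" "u < 3" by (simp_all add: u_def)
  have qu: "3 * q + u = 7 * m - 6 * n"
    using three_times_div_three[of m "2 * m - 2 * n"] by (simp add: q_def u_def algebra_simps)
  obtain a b c d e where x: "edge_vector G = (a, b, c, d, e)" by (metis prod.exhaust)
  have sc: "score G = 217 * e - 296 * b" using x by (simp add: score_def edge_vector_def)
  obtain p where p: "m = a + b + c + d + e" "6 * n = 9 * a + 8 * b + 6 * c + 5 * d + 4 * e"
    "even (a + d)" "3 * p = b + d + 2 * e" "p \<noteq> 0 \<longrightarrow> a \<le> d"
    "p = 1 \<longrightarrow> e = 0" "p = 2 \<longrightarrow> e \<le> 1" "p = 3 \<longrightarrow> e \<le> 3"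
    "n \<le> m + 1" "2 * m \<le> 3 * n - 3" "7 \<le> n" "0 \<le> a" "0 \<le> b" "0 \<le> c" "0 \<le> d" "0 \<le> e"
    by (rule chemical_graph_constraints[OF G x, folded n_def m_def])
  have "score G \<le> s \<and> (score G = s \<longrightarrow>
    (a = (3 * n - 2 * m) div 3 \<and> b = 0 \<and> c = u \<and> d = (3 * n - 2 * m) div 3 \<and> e = q) \<or>
      (m + 1 = n \<and> n \<in> {7, 8, 9} \<and> a = 2 \<and> b = 0 \<and> c = m - 2 \<and> d = 0 \<and> e = 0))"
  proof (cases "a \<le> d")
    case True
    define k where "k = (d - a) div 2"
    have k: "d = a + 2 * k" "0 \<le> k"
      using even_sum_half_diff[OF p(3)] True by (simp_all add: k_def)
    have eq: "3 * q - 3 * e = 4 * k + c - b - u" using qu p(1,2) k(1) by algebra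
    have le: "217 * e - 296 * b \<le> 217 * q"
    proof (cases "b = 0")
      case True
      then have "q - e \<ge> 0" using eq u(1,2) p(14) k(2) by linarith
      then show ?thesis using True by simp
    next
      case False
      then have "b \<ge> 1" using p(13) by linarith
      then show ?thesis using eq u(1,2) p(14) k(2) by linarith
    qed
    moreover have "a = (3 * n - 2 * m) div 3 \<and> b = 0 \<and> c = u \<and> d = (3 * n - 2 * m) div 3 \<and> e = q"
      if "217 * e - 296 * b = 217 * q"
    proof -
      have b: "b = 0"
      proof (rule ccontr)
        assume "b \<noteq> 0"
        then have "b \<ge> 1" using p(13) by linarith
        then show False using that eq u(1,2) p(14) k(2) by linarith
      qed
      with that have e: "e = q" by simp
      then have "4 * k + c = u" using eq b by linarith
      moreover from this have "k = 0" using u(1,2) p(14) k(2) by linarith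
      ultimately have "c = u" by simp
      have "3 * n - 2 * m = 3 * a + u" using p(1,2) k(1) b \<open>k = 0\<close> \<open>c = u\<close> by linarith
      then have "(3 * n - 2 * m) div 3 = a" using u by simp
      then show ?thesis using b e k(1) \<open>k = 0\<close> \<open>c = u\<close> by simp
    qed
    ultimately show ?thesis unfolding sc s_def q_def[symmetric] by blast
  next
    case False
    then have "p = 0" using p(5) by blast
    then have 0: "b = 0" "d = 0" "e = 0" using p(4,13,15,16) by linarith+
    \<comment> \<open>connectedness, as \<open>n \<le> m + 1\<close>, bounds the number of leaves\<close>
    have "a \<le> 2" using p(1,2,9) 0 by linarith
    moreover have "a \<noteq> 1" using 0 p(3) by auto
    ultimately have a: "a = 2" using False 0 by linarith
    then have nm: "n = m + 1" "c = m - 2" using p(1,2) 0 by linarith+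
    \<comment> \<open>now \<open>3 q + u = m - 6\<close> with \<open>m \<ge> 6\<close>\<close>
    have q: "q \<ge> 0" "q = 0 \<longrightarrow> n \<in> {7, 8, 9}" using u qu nm p(11) by auto
    then show ?thesis using 0 a nm unfolding sc s_def q_def[symmetric] by auto
  qed
  then show "score G \<le> s"
    and "score G = s \<Longrightarrow> edge_vector G =
        ((3 * n - 2 * m) div 3, 0, m mod 3, (3 * n - 2 * m) div 3, (7 * m - 6 * n) div 3) \<or>
      (m + 1 = n \<and> n \<in> {7, 8, 9} \<and> edge_vector G = (2, 0, m - 2, 0, 0))"
    unfolding x u_def q_def by auto
qed

section \<open>Graphs that attain the bound\<close>

text \<open>
Only lower bounds on the score of the constructed graph are needed: the edges in \<open>E0\<close> end up with both
ends of degree three, and \<open>X\<close> contains the edges of type \<open>13\<close>.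
\<close>

lemma legged_realizes_score:
  fixes G :: "'a pair_pre_digraph"
  assumes G: "chemical_graph G"
    and L: "legged C X V E" and t: "(\<Sum>c\<in>C. 3 - vdeg E c) = t" and r: "r \<noteq> 0 \<Longrightarrow> t \<noteq> 0"
    and V: "V \<subseteq> pverts G" "graph_order G = card V + 2 * t + r"
    and size: "graph_size G = card E + 2 * t + r"
    and E0: "E0 \<subseteq> E" "\<And>e. e \<in> E0 \<Longrightarrow> e \<subseteq> C" and X: "finite X"
  shows "\<exists>H :: 'a pair_pre_digraph. chemical_graph H \<and> graph_order H = graph_order G \<and>
    graph_size H = graph_size G \<and> 217 * int (card E0) - 296 * int (card X) \<le> score H"
proof -
  let ?U = "pverts G"
  have fU: "finite ?U"
    using chemical_graph_subcubic[OF G] conn_graph_finite(1) unfolding subcubic_graph_def by blast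
  obtain E' where E': "legged C X ?U E'" "E \<subseteq> E'" "card E' = card E + 2 * t + r"
    "\<forall>c\<in>C. vdeg E' c = 3"
    using legged_complete[OF L t fU V(1) _ r] V(2) unfolding graph_order_def by blast
  have U: "conn_graph ?U E'" and CU: "C \<subseteq> ?U" and low: "\<And>v. v \<in> ?U - C \<Longrightarrow> vdeg E' v \<le> 2"
    and inX: "\<And>c v. c \<in> C \<Longrightarrow> v \<in> ?U - C \<Longrightarrow> {c, v} \<in> E' \<Longrightarrow> vdeg E' v = 1 \<Longrightarrow> {c, v} \<in> X"
    using E'(1) unfolding legged_def by blast+
  have fE: "finite E'" using conn_graph_finite(2)[OF U] .
  define H where "H = graph_of ?U E'"
  have pg: "pair_graph H" unfolding H_def by (rule pair_graph_graph_of[OF U])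
  have ue: "uedges H = E'" unfolding H_def by (rule uedges_graph_of[OF U])
  have pv: "pverts H = ?U" by (simp add: H_def graph_of_def)
  have n: "graph_order H = graph_order G" by (simp add: graph_order_def pv)
  have m: "graph_size H = graph_size G" using size E'(3) by (simp add: graph_size_def ue)
  have "deg H v \<le> 3" if v: "v \<in> ?U" for v
  proof (cases "v \<in> C")
    case True
    then show ?thesis using E'(4) by (simp add: deg_eq_vdeg[OF pg] ue)
  next
    case False
    then show ?thesis using low[of v] v by (simp add: deg_eq_vdeg[OF pg] ue)
  qed
  moreover have "Digraph_Component.connected (with_proj H)"
    unfolding H_def by (rule connected_graph_of[OF U])
  ultimately have ch: "chemical_graph H"
    using G pg n m pv unfolding chemical_graph_def by simp
  have "E0 \<subseteq> type_edges E' 3 3"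
  proof
    fix e assume e: "e \<in> E0"
    then have "e \<in> E'" using E0(1) E'(2) by blast
    moreover obtain u v where "e = {u, v}" by (rule conn_graph_edge[OF U \<open>e \<in> E'\<close>])
    moreover from this have "vdeg E' u = 3" "vdeg E' v = 3" using E0(2)[OF e] E'(4) by auto
    ultimately show "e \<in> type_edges E' 3 3" unfolding type_edges_def by blast
  qed
  then have "card E0 \<le> card (type_edges E' 3 3)"
    using fE by (intro card_mono) (simp_all add: type_edges_def)
  moreover have "type_edges E' 1 3 \<subseteq> X"
  proof
    fix e assume "e \<in> type_edges E' 1 3"
    then obtain u v where e: "e \<in> E'" "e = {v, u}" "vdeg E' u = 1" "vdeg E' v = 3"
      unfolding type_edges_def by (auto simp: insert_commute)
    have uv: "u \<in> ?U" "v \<in> ?U" using conn_graph_doubleton[OF U, of v u] e(1,2) by simp_all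
    have "v \<in> C" using low[of v] uv(2) e(4) by (cases "v \<in> C") simp_all
    moreover have "u \<notin> C" using E'(4) e(3) by auto
    ultimately show "e \<in> X" using inX[of v u] uv e(1-3) by simp
  qed
  then have "card (type_edges E' 1 3) \<le> card X" using X by (intro card_mono)
  ultimately have "217 * int (card E0) - 296 * int (card X) \<le> score H"
    unfolding score_def edge_count_type_edges[OF pg] ue by linarith
  with ch n m show ?thesis by blast
qed

text \<open>
The core has \<open>N = n - 2t - r\<close> vertices and \<open>k\<close> edges, and its deficiency is \<open>3N - 2k = t\<close>. As \<open>k - N = m - n\<close>,
the values \<open>(2, 2)\<close> and \<open>(3, 4)\<close> of \<open>(N, k)\<close> lead back to the three excluded pairs.
\<close>

lemma generic_attained:
  fixes G :: "'a pair_pre_digraph"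
  assumes G: "chemical_graph G"
  defines "n \<equiv> int (graph_order G)" and "m \<equiv> int (graph_size G)"
  assumes ns: "(n, m) \<notin> {(7, 7), (8, 8), (7, 8)}"
  shows "\<exists>H :: 'a pair_pre_digraph. chemical_graph H \<and> graph_order H = graph_order G \<and>
    graph_size H = graph_size G \<and> 217 * ((7 * m - 6 * n) div 3) \<le> score H"
proof -
  define t r k where "t = nat ((3 * n - 2 * m) div 3)" and "r = nat (m mod 3)"
    and "k = nat ((7 * m - 6 * n) div 3)"
  have nm: "n \<le> m + 1" "2 * m \<le> 3 * n - 3" "7 \<le> n"
    by (rule chemical_graph_constraints[OF G edge_vector_def, folded n_def m_def], assumption)+
  have r: "int r = m mod 3" by (simp add: r_def)
  have "int t = (3 * n - 2 * m) div 3" using nm by (simp add: t_def)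
  then have t: "3 * int t + int r = 3 * n - 2 * m" 
    unfolding r using three_times_div_three[of m "n - m"] by (simp add: algebra_simps)
  have k_div: "int k = (7 * m - 6 * n) div 3" using nm by (simp add: k_def)
  then have k: "3 * int k + int r = 7 * m - 6 * n"
    unfolding r using three_times_div_three[of m "2 * m - 2 * n"] by (simp add: algebra_simps)
  have "int r < 3" unfolding r by simp
  then have r3: "r < 3" by simp
  define N where "N = nat (n - 2 * int t - int r)"
  have N: "int N = n - 2 * int t - int r" unfolding N_def using t r3 nm by linarith
  have t1: "t \<ge> 1" using t r3 nm by linarith
  have N3: "3 * N = 2 * k + t" using N t k by linarith
  have "N \<le> k + 1" using N t k nm by linarith
  moreover have "2 * k < 3 * N" using N3 t1 by linarith
  moreover have "(N, k) \<notin> {(1, 1), (2, 2), (3, 4)}"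
  proof -
    have "\<not> (N = 1 \<and> k = 1)" using N t k nm r3 by linarith
    moreover have "\<not> (N = 2 \<and> k = 2)"
    proof
      assume "N = 2 \<and> k = 2"
      then have "m = n" "n = 6 + int r" using N t k by linarith+
      then show False using ns nm r3 by force
    qed
    moreover have "\<not> (N = 3 \<and> k = 4)"
    proof
      assume "N = 3 \<and> k = 4"
      then have "m = n + 1" "n = 5 + int r" using N t k by linarith+
      then show False using ns nm r3 by force
    qed
    ultimately show ?thesis by blast
  qed
  moreover have "N \<le> card (pverts G)" using N unfolding n_def graph_order_def by linarith
  then obtain V where V: "V \<subseteq> pverts G" "card V = N" by (metis obtain_subset_with_card_n)
  ultimately obtain E where E: "conn_graph V E" "card E = k" "\<forall>v\<in>V. vdeg E v \<le> 3"
    using subcubic_core[OF V(2)] by blast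
  have "(\<Sum>v\<in>V. 3 - vdeg E v) = (\<Sum>v\<in>V. 3) - (\<Sum>v\<in>V. vdeg E v)"
    using E(3) by (intro sum_subtractf_nat) simp
  also have "\<dots> = t" using degree_sum[OF E(1)] E(2) V(2) N3 by simp
  finally have T: "(\<Sum>v\<in>V. 3 - vdeg E v) = t" .
  have order: "graph_order G = card V + 2 * t + r" using N V(2) unfolding n_def by linarith
  have size: "graph_size G = card E + 2 * t + r" using t k E(2) unfolding m_def n_def by linarith
  have "\<exists>H :: 'a pair_pre_digraph. chemical_graph H \<and> graph_order H = graph_order G \<and>
    graph_size H = graph_size G \<and>
    217 * int (card E) - 296 * int (card ({} :: 'a set set)) \<le> score H"
    by (rule legged_realizes_score[OF G legged_core[OF E(1,3)] T _ V(1) order size])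
      (use t1 conn_graphD(3)[OF E(1)] in simp_all)
  moreover have "(7 * m - 6 * n) div 3 = int (card E)" unfolding E(2) using k_div by simp
  ultimately show ?thesis by simp
qed

text \<open>
A triangle \<open>a b c\<close> with hanging paths of length two at \<open>a\<close> and \<open>b\<close>; the vertex \<open>c\<close> keeps degree two.
\<close>

lemma attained_7_7:
  fixes G :: "'a pair_pre_digraph"
  assumes G: "chemical_graph G" and n: "graph_order G = 7" and m: "graph_size G = 7"
  shows "\<exists>H :: 'a pair_pre_digraph. chemical_graph H \<and> graph_order H = graph_order G \<and>
    graph_size H = graph_size G \<and> 217 \<le> score H"
proof -
  have "3 \<le> card (pverts G)" using n by (simp add: graph_order_def)
  then obtain V where V: "V \<subseteq> pverts G" "card V = 3" by (metis obtain_subset_with_card_n)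
  then obtain a b c where abc: "V = {a, b, c}" "a \<noteq> b" "a \<noteq> c" "b \<noteq> c"
    unfolding card_3_iff by blast
  define E where "E = {{a, b}, {b, c}, {a, c}}"
  have ne: "a \<noteq> b" "a \<noteq> c" "b \<noteq> c" "b \<noteq> a" "c \<noteq> a" "c \<noteq> b" using abc by auto
  have deg: "vdeg E a = 2" "vdeg E b = 2" "vdeg E c = 2"
    using ne by (simp_all add: E_def vdeg_insert doubleton_eq_iff)
  have G': "conn_graph V E" unfolding E_def abc(1) using abc(2-4) by (rule triangle)
  have "V - {a, b} = {c}" using abc ne by auto
  then have "legged {a, b} {} V E"
    using G' deg ne abc(1) unfolding legged_def by simp
  moreover have "(\<Sum>v\<in>{a, b}. 3 - vdeg E v) = 2" using ne deg by simp
  ultimately have "\<exists>H :: 'a pair_pre_digraph. chemical_graph H \<and> graph_order H = graph_order G \<and>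
    graph_size H = graph_size G \<and>
    217 * int (card {{a, b}}) - 296 * int (card ({} :: 'a set set)) \<le> score H"
    using V n m ne by (intro legged_realizes_score[OF G, where r = 0]) (auto simp: E_def doubleton_eq_iff)
  then show ?thesis by simp
qed

text \<open>
A triangle with a pendant vertex \<open>z\<close> at \<open>a\<close> and hanging paths of length two at \<open>b\<close> and \<open>c\<close>. The score
\<open>355\<close> is \<open>3 * 217 - 296\<close>.
\<close>

lemma attained_8_8:
  fixes G :: "'a pair_pre_digraph"
  assumes G: "chemical_graph G" and n: "graph_order G = 8" and m: "graph_size G = 8"
  shows "\<exists>H :: 'a pair_pre_digraph. chemical_graph H \<and> graph_order H = graph_order G \<and>
    graph_size H = graph_size G \<and> 355 \<le> score H"
proof -
  have "4 \<le> card (pverts G)" using n by (simp add: graph_order_def)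
  then obtain V where V: "V \<subseteq> pverts G" "card V = 4" by (metis obtain_subset_with_card_n)
  obtain a b c z where abc: "V = {a, b, c, z}" "distinct [a, b, c, z]"
    using card_4_obtain[OF V(2)] .
  define E where "E = insert {a, z} {{a, b}, {b, c}, {a, c}}"
  have ne: "a \<noteq> b" "a \<noteq> c" "b \<noteq> c" "b \<noteq> a" "c \<noteq> a" "c \<noteq> b"
    "a \<noteq> z" "b \<noteq> z" "c \<noteq> z" "z \<noteq> a" "z \<noteq> b" "z \<noteq> c" using abc by auto
  have deg: "vdeg E a = 3" "vdeg E b = 2" "vdeg E c = 2" "vdeg E z = 1"
    using ne by (simp_all add: E_def vdeg_insert doubleton_eq_iff)
  have "conn_graph (insert z {a, b, c}) E"
    unfolding E_def using ne by (intro conn_graph_pendant triangle) simp_all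
  moreover have "insert z {a, b, c} = V" using abc by auto
  ultimately have G': "conn_graph V E" by simp
  have "V - {a, b, c} = {z}" using abc ne by auto
  then have "legged {a, b, c} {{a, z}} V E"
    using G' deg ne abc(1) unfolding legged_def by (simp add: E_def doubleton_eq_iff)
  moreover have "(\<Sum>v\<in>{a, b, c}. 3 - vdeg E v) = 2" using ne deg by simp
  moreover have "card E = 4" using ne by (simp add: E_def doubleton_eq_iff)
  moreover have "{{a, b}, {b, c}, {a, c}} \<subseteq> E" by (auto simp: E_def)
  ultimately have "\<exists>H :: 'a pair_pre_digraph. chemical_graph H \<and> graph_order H = graph_order G \<and>
    graph_size H = graph_size G \<and>
    217 * int (card {{a, b}, {b, c}, {a, c}}) - 296 * int (card {{a, z}}) \<le> score H"
    using V n m by (intro legged_realizes_score[OF G, where r = 0]) auto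
  moreover have "card {{a, b}, {b, c}, {a, c}} = 3" using ne by (simp add: doubleton_eq_iff)
  ultimately show ?thesis by simp
qed

text \<open>
\<open>K4\<close> without \<open>{a, d}\<close>, with a pendant vertex \<open>z\<close> at \<open>a\<close> and a hanging path of length two at \<open>d\<close>. The
score \<open>789\<close> is \<open>5 * 217 - 296\<close>.
\<close>

lemma attained_7_8:
  fixes G :: "'a pair_pre_digraph"
  assumes G: "chemical_graph G" and n: "graph_order G = 7" and m: "graph_size G = 8"
  shows "\<exists>H :: 'a pair_pre_digraph. chemical_graph H \<and> graph_order H = graph_order G \<and>
    graph_size H = graph_size G \<and> 789 \<le> score H"
proof -
  have "5 \<le> card (pverts G)" using n by (simp add: graph_order_def)
  then obtain V where V: "V \<subseteq> pverts G" "card V = 5" by (metis obtain_subset_with_card_n)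
  obtain z where z: "z \<in> V" using card_pos_obtain[OF V(2)] by auto
  have "card (V - {z}) = 4" using V(2) z by simp
  then obtain a b c d where abc: "V - {z} = {a, b, c, d}" "distinct [a, b, c, d]"
    by (rule card_4_obtain)
  define D where "D = {{a, b}, {b, c}, {a, c}, {b, d}, {c, d}}"
  define E where "E = insert {a, z} D"
  have ne: "a \<noteq> b" "a \<noteq> c" "b \<noteq> c" "b \<noteq> a" "c \<noteq> a" "c \<noteq> b"
    "a \<noteq> d" "b \<noteq> d" "c \<noteq> d" "d \<noteq> a" "d \<noteq> b" "d \<noteq> c"
    "a \<noteq> z" "b \<noteq> z" "c \<noteq> z" "d \<noteq> z" "z \<noteq> a" "z \<noteq> b" "z \<noteq> c" "z \<noteq> d"
    using abc by auto
  have deg: "vdeg E a = 3" "vdeg E b = 3" "vdeg E c = 3" "vdeg E d = 2" "vdeg E z = 1"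
    using ne by (simp_all add: E_def D_def vdeg_insert doubleton_eq_iff)
  have cD: "card D = 5" using ne by (simp add: D_def doubleton_eq_iff)
  have "{a, z} \<notin> D" using ne by (simp add: D_def doubleton_eq_iff)
  then have cE: "card E = 6" using cD by (simp add: E_def D_def)
  have "conn_graph (insert z {a, b, c, d}) E"
    unfolding E_def D_def using ne abc(2) by (intro conn_graph_pendant diamond) simp_all
  moreover have VC: "insert z {a, b, c, d} = V" using abc(1) z by auto
  ultimately have G': "conn_graph V E" by simp
  have "V - {a, b, c, d} = {z}" using abc(1) ne z by auto
  then have "legged {a, b, c, d} {{a, z}} V E"
    using G' deg ne unfolding legged_def VC[symmetric]
    by (auto simp: E_def D_def doubleton_eq_iff)
  moreover have "(\<Sum>v\<in>{a, b, c, d}. 3 - vdeg E v) = 1" using ne deg by simp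
  moreover have "D \<subseteq> E" by (auto simp: E_def)
  moreover have "e \<subseteq> {a, b, c, d}" if "e \<in> D" for e using that by (auto simp: D_def)
  ultimately have "\<exists>H :: 'a pair_pre_digraph. chemical_graph H \<and> graph_order H = graph_order G \<and>
    graph_size H = graph_size G \<and> 217 * int (card D) - 296 * int (card {{a, z}}) \<le> score H"
    using V n m cE by (intro legged_realizes_score[OF G, where r = 0]) auto
  then show ?thesis using cD by simp
qed

section \<open>The exceptional pairs of order and size\<close>

lemma score_edge_vector:
  assumes "edge_vector G = (a, b, c, d, e)"
  shows "score G = 217 * e - 296 * b"
  using assms by (simp add: score_def edge_vector_def)

text \<open>
A positive score forces a vertex of degree three, hence \<open>a \<le> d\<close>. The number \<open>p\<close> of these vertices is
eliminated by \<open>3 p = a + b + 2 * k + 2 * e\<close>.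
\<close>

lemma positive_score_constraints:
  assumes G: "chemical_graph G" and v: "edge_vector G = (a, b, c, d, e)"
    and n: "int (graph_order G) = n" and m: "int (graph_size G) = m"
    and pos: "0 < 217 * e - 296 * b"
  obtains k where "0 \<le> k" "d = a + 2 * k" "3 * e = 7 * m - 6 * n - 4 * k - c + b"
    "m = 2 * a + 2 * k + b + c + e" "0 \<le> a" "0 \<le> b" "0 \<le> c" "0 \<le> e"
    "a + b + 2 * k + 2 * e = 3 \<longrightarrow> e = 0" "a + b + 2 * k + 2 * e = 6 \<longrightarrow> e \<le> 1"
    "a + b + 2 * k + 2 * e = 9 \<longrightarrow> e \<le> 3"
proof -
  obtain p where p: "m = a + b + c + d + e" "6 * n = 9 * a + 8 * b + 6 * c + 5 * d + 4 * e"
    "even (a + d)" "3 * p = b + d + 2 * e" "p \<noteq> 0 \<longrightarrow> a \<le> d"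
    "p = 1 \<longrightarrow> e = 0" "p = 2 \<longrightarrow> e \<le> 1" "p = 3 \<longrightarrow> e \<le> 3"
    "n \<le> m + 1" "2 * m \<le> 3 * n - 3" "7 \<le> n" "0 \<le> a" "0 \<le> b" "0 \<le> c" "0 \<le> d" "0 \<le> e"
    by (rule chemical_graph_constraints[OF G v, unfolded n m])
  have "0 < e" using pos p(13) by linarith
  then have "0 < p" using p(4,13,15) by linarith
  then have "a \<le> d" using p(5) by simp
  define k where "k = (d - a) div 2"
  have k: "d = a + 2 * k" "0 \<le> k"
    using even_sum_half_diff[OF p(3)] \<open>a \<le> d\<close> by (simp_all add: k_def)
  show thesis
  proof (rule that[of k])
    show "3 * e = 7 * m - 6 * n - 4 * k - c + b" using p(1,2) k(1) by algebra
    show "m = 2 * a + 2 * k + b + c + e" using p(1) k(1) by simp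
    have "3 * p = a + b + 2 * k + 2 * e" using p(4) k(1) by simp
    then show "a + b + 2 * k + 2 * e = 3 \<longrightarrow> e = 0" "a + b + 2 * k + 2 * e = 6 \<longrightarrow> e \<le> 1"
      "a + b + 2 * k + 2 * e = 9 \<longrightarrow> e \<le> 3" using p(6,7,8) by auto
  qed (use k p in simp_all)
qed

text \<open>
For small order the linear relations leave only a few edge counts with a score at least that of the
constructed graph. The competitors of the vector below have too many edges of type \<open>33\<close> for their
number of vertices of degree three; the same happens for the other two pairs.
\<close>

lemma edge_vector_unique_7_7:
  assumes G: "chemical_graph G" and n: "graph_order G = 7" and m: "graph_size G = 7"
    and ge: "217 \<le> score G"
  shows "edge_vector G = (2, 0, 0, 4, 1)"
proof -
  obtain a b c d e where v: "edge_vector G = (a, b, c, d, e)" by (metis prod.exhaust)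
  have s: "217 \<le> 217 * e - 296 * b" using ge score_edge_vector[OF v] by simp
  have nm: "int (graph_order G) = 7" "int (graph_size G) = 7" using n m by simp_all
  have pos: "0 < 217 * e - 296 * b" using s by simp
  obtain k where k: "0 \<le> k" "d = a + 2 * k" "3 * e = 7 * 7 - 6 * 7 - 4 * k - c + b"
    "7 = 2 * a + 2 * k + b + c + e" "0 \<le> a" "0 \<le> b" "0 \<le> c" "0 \<le> e"
    "a + b + 2 * k + 2 * e = 3 \<longrightarrow> e = 0" "a + b + 2 * k + 2 * e = 6 \<longrightarrow> e \<le> 1"
    "a + b + 2 * k + 2 * e = 9 \<longrightarrow> e \<le> 3"
    by (rule positive_score_constraints[OF G v nm pos])
  have "e \<le> 2" using s k(1,3,7) by linarith
  then have b: "b = 0" using s k(6) by linarith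
  with s have "1 \<le> e" by simp
  with \<open>e \<le> 2\<close> consider "e = 1" "k = 0" | "e = 1" "k = 1" | "e = 2"
    using k(1,3,7) b by linarith
  then show ?thesis
  proof cases
    case 1
    then have "a = 1" using k(3,4) b by linarith
    then show ?thesis using k(9) b 1 by simp
  next
    case 2
    then have "c = 0" "a = 2" using k(3,4) b by linarith+
    then show ?thesis using v k(2) b 2 by simp
  next
    case 3
    then have "k = 0" using k(1,3,7) b by linarith
    then have "c = 1" using k(3) b 3 by linarith
    with \<open>k = 0\<close> have "a = 2" using k(4) b 3 by linarith
    then show ?thesis using k(10) b 3 \<open>k = 0\<close> by simp
  qed
qed

lemma edge_vector_unique_8_8:
  assumes G: "chemical_graph G" and n: "graph_order G = 8" and m: "graph_size G = 8"
    and ge: "355 \<le> score G"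
  shows "edge_vector G = (2, 1, 0, 2, 3)"
proof -
  obtain a b c d e where v: "edge_vector G = (a, b, c, d, e)" by (metis prod.exhaust)
  have s: "355 \<le> 217 * e - 296 * b" using ge score_edge_vector[OF v] by simp
  have nm: "int (graph_order G) = 8" "int (graph_size G) = 8" using n m by simp_all
  have pos: "0 < 217 * e - 296 * b" using s by simp
  obtain k where k: "0 \<le> k" "d = a + 2 * k" "3 * e = 7 * 8 - 6 * 8 - 4 * k - c + b"
    "8 = 2 * a + 2 * k + b + c + e" "0 \<le> a" "0 \<le> b" "0 \<le> c" "0 \<le> e"
    "a + b + 2 * k + 2 * e = 3 \<longrightarrow> e = 0" "a + b + 2 * k + 2 * e = 6 \<longrightarrow> e \<le> 1"
    "a + b + 2 * k + 2 * e = 9 \<longrightarrow> e \<le> 3"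
    by (rule positive_score_constraints[OF G v nm pos])
  have "e \<le> 3" using s k(1,3,7) by linarith
  moreover have "2 \<le> e" using s k(6) by linarith
  ultimately consider "e = 2" | "e = 3" by linarith
  then show ?thesis
  proof cases
    case 1
    then have b: "b = 0" using s k(6) by linarith
    then have "k = 0" using k(1,3,7) 1 by linarith
    then have "c = 2" using k(3) b 1 by linarith
    with \<open>k = 0\<close> have "a = 2" using k(4) b 1 by linarith
    then show ?thesis using k(10) b 1 \<open>k = 0\<close> by simp
  next
    case 2
    then have "b \<le> 1" using s by linarith
    then have "b = 1" "k = 0" "c = 0" using k(1,3,7) 2 by linarith+
    moreover from this have "a = 2" using k(4) 2 by linarith
    ultimately show ?thesis using v k(2) 2 by simp
  qed
qed

lemma edge_vector_unique_7_8:
  assumes G: "chemical_graph G" and n: "graph_order G = 7" and m: "graph_size G = 8"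
    and ge: "789 \<le> score G"
  shows "edge_vector G = (1, 1, 0, 1, 5)"
proof -
  obtain a b c d e where v: "edge_vector G = (a, b, c, d, e)" by (metis prod.exhaust)
  have s: "789 \<le> 217 * e - 296 * b" using ge score_edge_vector[OF v] by simp
  have nm: "int (graph_order G) = 7" "int (graph_size G) = 8" using n m by simp_all
  have pos: "0 < 217 * e - 296 * b" using s by simp
  obtain k where k: "0 \<le> k" "d = a + 2 * k" "3 * e = 7 * 8 - 6 * 7 - 4 * k - c + b"
    "8 = 2 * a + 2 * k + b + c + e" "0 \<le> a" "0 \<le> b" "0 \<le> c" "0 \<le> e"
    "a + b + 2 * k + 2 * e = 3 \<longrightarrow> e = 0" "a + b + 2 * k + 2 * e = 6 \<longrightarrow> e \<le> 1"
    "a + b + 2 * k + 2 * e = 9 \<longrightarrow> e \<le> 3"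
    by (rule positive_score_constraints[OF G v nm pos])
  have "e \<le> 5" using s k(1,3,7) by linarith
  moreover have "4 \<le> e" using s k(6) by linarith
  ultimately consider "e = 4" | "e = 5" by linarith
  then show ?thesis
  proof cases
    case 1
    then have b: "b = 0" using s k(6) by linarith
    then have "k = 0" using k(1,3,7) 1 by linarith
    then have "c = 2" using k(3) b 1 by linarith
    with \<open>k = 0\<close> have "a = 1" using k(4) b 1 by linarith
    then show ?thesis using k(11) b 1 \<open>k = 0\<close> by simp
  next
    case 2
    then have "b \<le> 1" using s by linarith
    then have "b = 1" "k = 0" "c = 0" using k(1,3,7) 2 by linarith+
    moreover from this have "a = 1" using k(4) 2 by linarith
    ultimately show ?thesis using v k(2) 2 by simp
  qed
qed

section \<open>Characterization of the maximizers\<close>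

lemma maximizes_iff_edge_vector:
  fixes G :: "'a pair_pre_digraph"
  assumes G: "chemical_graph G" and x: "217 * e - 296 * b = s"
    and unique: "\<And>H :: 'a pair_pre_digraph. chemical_graph H \<Longrightarrow> graph_order H = graph_order G \<Longrightarrow>
      graph_size H = graph_size G \<Longrightarrow> s \<le> score H \<Longrightarrow> edge_vector H = (a, b, c, d, e)"
    and ge: "\<exists>H :: 'a pair_pre_digraph. chemical_graph H \<and> graph_order H = graph_order G \<and>
      graph_size H = graph_size G \<and> s \<le> score H"
  shows "maximizes aZagreb G \<longleftrightarrow> edge_vector G = (a, b, c, d, e)"
proof -
  have "score H \<le> s" if H: "chemical_graph H" "graph_order H = graph_order G"
    "graph_size H = graph_size G" for H :: "'a pair_pre_digraph"
    using unique[OF H] score_edge_vector[of H a b c d e] x by linarith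
  then have "maximizes aZagreb G \<longleftrightarrow> score G = s" using G ge by (intro maximizes_iff_score) auto
  also have "\<dots> \<longleftrightarrow> edge_vector G = (a, b, c, d, e)"
    using unique[OF G] score_edge_vector[of G a b c d e] x by auto
  finally show ?thesis .
qed

text \<open>
For trees of order \<open>7\<close>, \<open>8\<close> or \<open>9\<close> the generic vector is \<open>(3, 0, m - 6, 3, 0)\<close>, and the path has the same
score \<open>0\<close>. This accounts for the two alternatives in the first branch of the definition.
\<close>

lemma F8_iff_score:
  assumes G: "chemical_graph G"
  defines "n \<equiv> int (graph_order G)" and "m \<equiv> int (graph_size G)"
  assumes ns: "(n, m) \<notin> {(7, 7), (8, 8), (7, 8)}"
  shows "G \<in> F8 \<longleftrightarrow> score G = 217 * ((7 * m - 6 * n) div 3)"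
proof -
  let ?g = "((3 * n - 2 * m) div 3, 0, m mod 3, (3 * n - 2 * m) div 3, (7 * m - 6 * n) div 3)"
  have tree: "?g = (3, 0, m - 6, 3, 0)" "(7 * m - 6 * n) div 3 = 0"
    if "m + 1 = n" "n \<in> {7, 8, 9}"
  proof -
    have "n = 7 \<and> m = 6 \<or> n = 8 \<and> m = 7 \<or> n = 9 \<and> m = 8" using that by auto
    then show "?g = (3, 0, m - 6, 3, 0)" "(7 * m - 6 * n) div 3 = 0" by auto
  qed
  have "G \<in> F8 \<longleftrightarrow> edge_vector G = ?g \<or>
    (m + 1 = n \<and> n \<in> {7, 8, 9} \<and> edge_vector G = (2, 0, m - 2, 0, 0))"
  proof (cases "m + 1 = n \<and> n \<in> {7, 8, 9}")
    case True
    then have "G \<in> F8 \<longleftrightarrow> edge_vector G = (2, 0, m - 2, 0, 0) \<or> edge_vector G = (3, 0, m - 6, 3, 0)"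
      using G by (simp only: F8_def Let_def mem_Collect_eq n_def[symmetric] m_def[symmetric] if_True simp_thms)
    then show ?thesis using True tree by auto
  next
    case False
    moreover have "\<not> (m = n \<and> n \<in> {7, 8})" "\<not> (n = 7 \<and> m = 8)" using ns by auto
    ultimately have "G \<in> F8 \<longleftrightarrow> edge_vector G = ?g"
      using G by (simp only: F8_def Let_def mem_Collect_eq n_def[symmetric] m_def[symmetric] if_False simp_thms)
    then show ?thesis using False by blast
  qed
  also have "\<dots> \<longleftrightarrow> score G = 217 * ((7 * m - 6 * n) div 3)"
  proof
    assume "score G = 217 * ((7 * m - 6 * n) div 3)"
    then show "edge_vector G = ?g \<or>
      (m + 1 = n \<and> n \<in> {7, 8, 9} \<and> edge_vector G = (2, 0, m - 2, 0, 0))"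
      using score_bound(2)[OF G] unfolding n_def m_def by blast
  next
    assume "edge_vector G = ?g \<or>
      (m + 1 = n \<and> n \<in> {7, 8, 9} \<and> edge_vector G = (2, 0, m - 2, 0, 0))"
    then show "score G = 217 * ((7 * m - 6 * n) div 3)"
    proof
      assume "edge_vector G = ?g"
      from score_edge_vector[OF this] show ?thesis by simp
    next
      assume *: "m + 1 = n \<and> n \<in> {7, 8, 9} \<and> edge_vector G = (2, 0, m - 2, 0, 0)"
      then have "score G = 0" using score_edge_vector[of G 2 0 "m - 2" 0 0] by simp
      then show ?thesis using tree(2) * by simp
    qed
  qed
  finally show ?thesis .
qed

theorem theorem20:
  fixes G :: "'a pair_pre_digraph" and n m :: nat
  assumes "chemical_graph G" and "graph_order G = n" and "graph_size G = m"
  shows "((n, m) \<notin> {(7, 8), (8, 8)} \<longrightarrow> (maximizes aZagreb G \<longleftrightarrow> G \<in> F8)) \<and>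
    (n = 7 \<and> m = 8 \<longrightarrow>
       (maximizes aZagreb G \<longleftrightarrow>
          edge_count G 1 2 = 1 \<and> edge_count G 1 3 = 1 \<and> edge_count G 2 3 = 1 \<and>
          edge_count G 2 2 = 0 \<and> edge_count G 3 3 = 5)) \<and>
    (n = 8 \<and> m = 8 \<longrightarrow>
       (maximizes aZagreb G \<longleftrightarrow>
          edge_count G 1 2 = 2 \<and> edge_count G 2 3 = 2 \<and> edge_count G 1 3 = 1 \<and>
          edge_count G 2 2 = 0 \<and> edge_count G 3 3 = 3))"
proof (intro conjI impI)
  note G = assms(1)
  assume nm: "(n, m) \<notin> {(7, 8), (8, 8)}"
  show "maximizes aZagreb G \<longleftrightarrow> G \<in> F8"
  proof (cases "n = 7 \<and> m = 7")
    case True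
    then have *: "graph_order G = 7" "graph_size G = 7" using assms by auto
    have "maximizes aZagreb G \<longleftrightarrow> edge_vector G = (2, 0, 0, 4, 1)"
      using edge_vector_unique_7_7 attained_7_7[OF G *] *
      by (intro maximizes_iff_edge_vector[OF G, where s = 217]) auto
    also have "\<dots> \<longleftrightarrow> G \<in> F8" using G * by (simp add: F8_def)
    finally show ?thesis .
  next
    case False
    let ?s = "217 * ((7 * int m - 6 * int n) div 3)"
    have ns: "(int (graph_order G), int (graph_size G)) \<notin> {(7, 7), (8, 8), (7, 8)}"
      using nm False assms by auto
    have "maximizes aZagreb G \<longleftrightarrow> score G = ?s"
    proof (rule maximizes_iff_score[OF G])
      fix H :: "'a pair_pre_digraph"
      assume "chemical_graph H" "graph_order H = graph_order G" "graph_size H = graph_size G"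
      then show "score H \<le> ?s" using score_bound(1)[of H] assms by simp
    qed (use generic_attained[OF G ns] assms in simp)
    then show ?thesis using F8_iff_score[OF G ns] assms by simp
  qed
next
  note G = assms(1)
  assume "n = 7 \<and> m = 8"
  then have *: "graph_order G = 7" "graph_size G = 8" using assms by auto
  have "maximizes aZagreb G \<longleftrightarrow> edge_vector G = (1, 1, 0, 1, 5)"
    using edge_vector_unique_7_8 attained_7_8[OF G *] *
    by (intro maximizes_iff_edge_vector[OF G, where s = 789]) auto
  then show "maximizes aZagreb G \<longleftrightarrow>
    edge_count G 1 2 = 1 \<and> edge_count G 1 3 = 1 \<and> edge_count G 2 3 = 1 \<and>
    edge_count G 2 2 = 0 \<and> edge_count G 3 3 = 5" by (auto simp: edge_vector_def)
next
  note G = assms(1)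
  assume "n = 8 \<and> m = 8"
  then have *: "graph_order G = 8" "graph_size G = 8" using assms by auto
  have "maximizes aZagreb G \<longleftrightarrow> edge_vector G = (2, 1, 0, 2, 3)"
    using edge_vector_unique_8_8 attained_8_8[OF G *] *
    by (intro maximizes_iff_edge_vector[OF G, where s = 355]) auto
  then show "maximizes aZagreb G \<longleftrightarrow>
    edge_count G 1 2 = 2 \<and> edge_count G 2 3 = 2 \<and> edge_count G 1 3 = 1 \<and>
    edge_count G 2 2 = 0 \<and> edge_count G 3 3 = 3" by (auto simp: edge_vector_def)
qed

end
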